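(* For all integers $d_1,d_2\ge 0$, the Cartesian product $T(d_1)\times T(d_2)$ of a $d_1$-simplex $T(d_1)$ and a $d_2$-simplex $T(d_2)$ is $\lfloor (d_1+d_2)/2\rfloor$-linked.
   Context: A (convex) polytope is the convex hull of a finite set of points in some $\mathbb{R}^d$. A $d$-simplex $T(d)$ is the convex hull of $d+1$ affinely independent points in $\mathbb{R}^d$. The Cartesian product of a $d$-polytope $P\subset\mathbb{R}^{d}$ and a $d'$-polytope $P'\subset\mathbb{R}^{d'}$ is the polytope $P\times P'=\{(p,p')\in\mathbb{R}^{d+d'} : p\in P,\ p'\in P'\}$. The graph of a polytope is the undirected graph formed by its vertices and edges (its $0$- and $1$-dimensional faces). A polytope is called $k$-linked if its graph is $k$-linked. For an integer $k\ge 0$, a graph $G$ is $k$-linked if it has at least $2k$ vertices and, for every set $X$ of exactly $2k$ distinct vertices of $G$ and every partition of $X$ into pairs $\{s_1,t_1\},\ldots,\{s_k,t_k\}$, there exist $k$ pairwise vertex-disjoint paths $L_1,\ldots,L_k$ in $G$ such that $L_i$ joins $s_i$ to $t_i$ for each $i\in\{1,\ldots,k\}$ (for $k=0$ the condition is vacuous). *)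

theory Defs
  imports
    "HOL-Analysis.Analysis"
    "HOL-Library.Disjoint_Sets"
    "Graph_Theory.Graph_Theory"
begin

text \<open>Undirected graphs are symmetric digraphs, as in \<^theory>\<open>Graph_Theory.Digraph\<close>;
  \<^prop>\<open>vpath p G\<close> says that the vertices listed in \<open>p\<close> are distinct and that consecutive ones
  are adjacent.\<close>

text \<open>In \<open>k_linked\<close>, the condition \<open>card X = 2 * k\<close> makes the \<open>2 * k\<close> vertices \<open>s i, t i\<close>
  pairwise distinct, so that the sets \<open>{s i, t i}\<close> are disjoint pairs partitioning \<open>X\<close>. The guard
  \<open>finite (verts G)\<close> is there because \<^const>\<open>card\<close> is \<open>0\<close> on infinite sets.\<close>

definition k_linked :: "nat \<Rightarrow> ('a, 'b) pre_digraph \<Rightarrow> bool" where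
  "k_linked k G \<longleftrightarrow>
     (finite (verts G) \<longrightarrow> 2 * k \<le> card (verts G)) \<and>
     (\<forall>X s t. X \<subseteq> verts G \<and> card X = 2 * k \<and> X = (\<Union>i<k. {s i, t i}) \<longrightarrow>
        (\<exists>L. (\<forall>i<k. vpath (L i) G \<and> hd (L i) = s i \<and> last (L i) = t i) \<and>
             disjoint_family_on (\<lambda>i. set (L i)) {..<k}))"

text \<open>A 1-dimensional face of a polytope is the segment between two of its vertices; it contributes
  both orientations of the corresponding edge.\<close>

definition polytope_graph :: "'a::euclidean_space set \<Rightarrow> 'a pair_pre_digraph" where
  "polytope_graph P =
     \<lparr> pverts = {v. v extreme_point_of P},
       parcs = {(u, v). closed_segment u v edge_of P} \<rparr>"

definition polytope_k_linked :: "nat \<Rightarrow> 'a::euclidean_space set \<Rightarrow> bool" where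
  "polytope_k_linked k P \<longleftrightarrow> k_linked k (with_proj (polytope_graph P))"

lemma pair_graph_polytope_graph:
  assumes "polytope P"
  shows "pair_graph (polytope_graph P)"
proof -
  have ext: "u extreme_point_of P \<and> v extreme_point_of P"
    if "closed_segment u v edge_of P" for u v
  proof -
    have F: "closed_segment u v face_of P"
      using that by (simp add: edge_of_def)
    have "u extreme_point_of closed_segment u v" "v extreme_point_of closed_segment u v"
      by (auto simp: extreme_point_of_segment)
    with F show ?thesis
      by (meson extreme_point_of_face)
  qed
  have loop: "u \<noteq> v" if "closed_segment u v edge_of P" for u v
    using that by (auto simp: edge_of_def)
  have fin: "finite {v. v extreme_point_of P}"
    using assms finite_polyhedron_extreme_points polytope_imp_polyhedron by blast
  have fina: "finite {(u, v). closed_segment u v edge_of P}"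
    by (rule finite_subset[OF _ finite_cartesian_product[OF fin fin]]) (use ext in auto)
  have sym: "symmetric (with_proj (polytope_graph P))"
    by (auto simp: symmetric_def polytope_graph_def sym_def closed_segment_commute)
  show ?thesis
    by unfold_locales (use ext loop fin fina sym in \<open>auto simp: polytope_graph_def\<close>)
qed

lemma parcs_polytope_graph_iff:
  assumes "polytope P"
  shows "(u, v) \<in> parcs (polytope_graph P) \<longleftrightarrow>
    (\<exists>e. e edge_of P \<and> u \<noteq> v \<and> {x. x extreme_point_of e} = {u, v})" (is "?l \<longleftrightarrow> ?r")
proof
  assume ?l
  then have e: "closed_segment u v edge_of P"
    by (simp add: polytope_graph_def)
  then have "u \<noteq> v"
    by (auto simp: edge_of_def)
  moreover have "{x. x extreme_point_of closed_segment u v} = {u, v}"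
    by (auto simp: extreme_point_of_segment)
  ultimately show ?r
    using e by blast
next
  assume ?r
  then obtain e where e: "e edge_of P" "{x. x extreme_point_of e} = {u, v}"
    by blast
  have "polytope e"
    using assms e(1) face_of_polytope_polytope by (auto simp: edge_of_def)
  then have "e = convex hull {u, v}"
    using e(2) Krein_Milman_Minkowski polytope_imp_compact polytope_imp_convex by metis
  then show ?l
    using e(1) by (simp add: polytope_graph_def segment_convex_hull)
qed

end

theory Submission
  imports Defs
begin

text \<open>
  The vertices of the product are the cells of a grid \<open>A \<times> B\<close>, two cells being adjacent when they share
  a line. The statement that goes through by induction on \<open>|A| + |B|\<close> allows obstacles: disjoint blocks
  of at most two cells each (a pair to be linked, or a single obstacle), with at most \<open>|A| + |B| - 2\<close>
  cells altogether, can be enlarged to disjoint sets connecting them. The induction step deletes a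
  set \<open>D\<close> of columns. Some blocks are linked inside \<open>D\<close>, possibly leaving one of their cells behind as
  an obstacle; the other marked cells of \<open>D\<close> move along their rows to free cells outside \<open>D\<close>. This
  is possible as soon as the blocks linked inside \<open>D\<close> have at least \<open>|D|\<close> cells there and the
  rows have room for the moves.

  Let \<open>|A| \<le> |B|\<close> and suppose that no deletion is possible. There is an empty column, all
  other columns have at least two marked cells, and each block consists of two opposite corners of a
  rectangle whose other two corners are marked too. Two blocks that share a column also share a row.
  The two columns of a block together meet all rows, since otherwise the block could be linked through
  a row that is free in both. Moreover, there are fewer empty lines than blocks, since otherwise each
  block could be linked through an empty line of its own. Counting shows that any two blocks share a
  column, hence also a row. It follows that each nonempty row has exactly two marked cells, so that all
  blocks lie in the same two columns, which contradicts the count of nonempty lines.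
\<close>

subsection \<open>Deleting columns of the grid\<close>

text \<open>Adjacency of cells made reflexive; the paths extracted at the end have distinct cells,
  so that only proper edges are used.\<close>

definition rook :: "(('a \<times> 'b) \<times> ('a \<times> 'b)) set" where
  "rook = {(x, y). fst x = fst y \<or> snd x = snd y}"

text \<open>For \<open>S\<close> inside \<open>C\<close>: one component of the rook graph on
  \<open>C\<close> contains \<open>S\<close>. A single obstacle is joined in every
  \<open>C\<close>.\<close>

definition joined :: "('a \<times> 'b) set \<Rightarrow> ('a \<times> 'b) set \<Rightarrow> bool" where
  "joined C S \<longleftrightarrow> (\<forall>x\<in>S. \<forall>y\<in>S. (x, y) \<in> (rook \<inter> C \<times> C)\<^sup>*)"

lemma sym_rook_walk: "(x, y) \<in> (rook \<inter> C \<times> C)\<^sup>* \<Longrightarrow> (y, x) \<in> (rook \<inter> C \<times> C)\<^sup>*"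
  by (rule symD[OF sym_rtrancl]) (auto simp: sym_def rook_def)

lemma rook_walk_mono: "(x, y) \<in> (rook \<inter> C \<times> C)\<^sup>* \<Longrightarrow> C \<subseteq> C' \<Longrightarrow> (x, y) \<in> (rook \<inter> C' \<times> C')\<^sup>*"
  by (erule subsetD[OF rtrancl_mono, rotated]) auto

lemma joined_mono: "joined C S \<Longrightarrow> C \<subseteq> C' \<Longrightarrow> joined C' S"
  unfolding joined_def using rook_walk_mono by blast

text \<open>\<open>H\<close> serves as a hub: the cells of a block walk to the crossings with a
  chosen line, or to their shifted copies.\<close>

lemma joined_via:
  assumes "joined C H" and "\<And>x. x \<in> S \<Longrightarrow> \<exists>h\<in>H. (x, h) \<in> (rook \<inter> C \<times> C)\<^sup>*"
  shows "joined C S"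
  unfolding joined_def
proof (intro ballI)
  fix x y assume "x \<in> S" "y \<in> S"
  obtain h where h: "h \<in> H" "(x, h) \<in> (rook \<inter> C \<times> C)\<^sup>*"
    using assms(2)[OF \<open>x \<in> S\<close>] by blast
  obtain h' where h': "h' \<in> H" "(y, h') \<in> (rook \<inter> C \<times> C)\<^sup>*"
    using assms(2)[OF \<open>y \<in> S\<close>] by blast
  have "(h, h') \<in> (rook \<inter> C \<times> C)\<^sup>*"
    using assms(1) h(1) h'(1) unfolding joined_def by blast
  with h(2) have "(x, h') \<in> (rook \<inter> C \<times> C)\<^sup>*"
    by (rule rtrancl_trans)
  from this sym_rook_walk[OF h'(2)] show "(x, y) \<in> (rook \<inter> C \<times> C)\<^sup>*"
    by (rule rtrancl_trans)
qed

text \<open>The cells move along their rows to column \<open>c\<close> and meet there. Only the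
  crossings are occupied, so blocks without a common row can use the same column.\<close>

lemma joined_column: "joined (S \<union> fst ` S \<times> {c}) S"
proof (rule joined_via)
  show "joined (S \<union> fst ` S \<times> {c}) (fst ` S \<times> {c})"
    unfolding joined_def by (auto intro!: r_into_rtrancl simp: rook_def)
  show "\<exists>h\<in>fst ` S \<times> {c}. (x, h) \<in> (rook \<inter> (S \<union> fst ` S \<times> {c}) \<times> (S \<union> fst ` S \<times> {c}))\<^sup>*"
    if "x \<in> S" for x
    using that by (intro bexI[of _ "(fst x, c)"] r_into_rtrancl) (auto simp: rook_def)
qed

lemma joined_row: "joined (S \<union> {r} \<times> snd ` S) S"
proof (rule joined_via)
  show "joined (S \<union> {r} \<times> snd ` S) ({r} \<times> snd ` S)"
    unfolding joined_def by (auto intro!: r_into_rtrancl simp: rook_def)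
  show "\<exists>h\<in>{r} \<times> snd ` S. (x, h) \<in> (rook \<inter> (S \<union> {r} \<times> snd ` S) \<times> (S \<union> {r} \<times> snd ` S))\<^sup>*"
    if "x \<in> S" for x
    using that by (intro bexI[of _ "(r, snd x)"] r_into_rtrancl) (auto simp: rook_def)
qed

definition linkable :: "'a set \<Rightarrow> 'b set \<Rightarrow> 'i set \<Rightarrow> ('i \<Rightarrow> ('a \<times> 'b) set) \<Rightarrow> bool" where
  "linkable A B I \<beta> \<longleftrightarrow>
    (\<exists>C. disjoint_family_on C I \<and> (\<forall>i\<in>I. \<beta> i \<subseteq> C i \<and> C i \<subseteq> A \<times> B \<and> joined (C i) (\<beta> i)))"

text \<open>A block \<open>\<beta> i\<close> is a pair to be linked, an obstacle (one cell), or empty.\<close>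

locale rook_blocks =
  fixes A :: "'a set" and B :: "'b set" and I :: "'i set" and \<beta> :: "'i \<Rightarrow> ('a \<times> 'b) set"
  assumes fin: "finite A" "finite B" "finite I"
    and disj: "disjoint_family_on \<beta> I"
    and sub: "i \<in> I \<Longrightarrow> \<beta> i \<subseteq> A \<times> B"
    and card2: "i \<in> I \<Longrightarrow> card (\<beta> i) \<le> 2"
    and few: "card (\<Union>i\<in>I. \<beta> i) + 2 \<le> card A + card B"
begin

abbreviation marks :: "('a \<times> 'b) set" where
  "marks \<equiv> \<Union>i\<in>I. \<beta> i"

definition col :: "'b \<Rightarrow> 'a set" where
  "col c = {r. (r, c) \<in> marks}"

definition row :: "'a \<Rightarrow> 'b set" where
  "row r = {c. (r, c) \<in> marks}"

lemma marks_sub: "marks \<subseteq> A \<times> B"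
  using sub by blast

lemma finite_marks: "finite marks"
  using marks_sub fin finite_subset by blast

lemma finite_block: "i \<in> I \<Longrightarrow> finite (\<beta> i)"
  using finite_marks by (auto intro: finite_subset)

lemma block_eq: "i \<in> I \<Longrightarrow> j \<in> I \<Longrightarrow> z \<in> \<beta> i \<Longrightarrow> z \<in> \<beta> j \<Longrightarrow> i = j"
  using disj unfolding disjoint_family_on_def by blast

text \<open>The blocks in \<open>K\<close> are linked inside \<open>D\<close>, the others are shifted out of \<open>D\<close> by \<open>\<phi>\<close>. The new blocks
  are the traces outside \<open>D\<close>.\<close>

lemma delete_columns:
  assumes D: "D \<subseteq> B" and K: "K \<subseteq> I"
    and E: "\<And>i. i \<in> K \<Longrightarrow> \<beta> i \<subseteq> E i \<and> E i \<subseteq> \<beta> i \<union> A \<times> D \<and> joined (E i) (\<beta> i)"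
    and E_disj: "disjoint_family_on E K"
    and E_other: "\<And>i j. i \<in> K \<Longrightarrow> j \<in> I - K \<Longrightarrow> E i \<inter> \<beta> j = {}"
    and kill: "card D \<le> card ((\<Union>i\<in>K. \<beta> i) \<inter> A \<times> D)"
    and room: "\<And>r. r \<in> A \<Longrightarrow> card {c \<in> D. (r, c) \<in> (\<Union>i\<in>I - K. \<beta> i)} \<le> card (B - D - row r)"
    and IH: "\<And>\<gamma>. rook_blocks A (B - D) I \<gamma> \<Longrightarrow> linkable A (B - D) I \<gamma>"
  shows "linkable A B I \<beta>"
proof -
  \<comment> \<open>The cells of row \<open>r\<close> that must leave \<open>D\<close>;
    \<open>room\<close> provides distinct free targets in the same row.\<close>
  define Z where "Z r = {c \<in> D. (r, c) \<in> (\<Union>i\<in>I - K. \<beta> i)}" for r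
  have "\<exists>g. inj_on g (Z r) \<and> g ` Z r \<subseteq> B - D - row r" if "r \<in> A" for r
  proof -
    have "finite (Z r)" "finite (B - D - row r)"
      using fin finite_subset[OF D] unfolding Z_def by auto
    then show ?thesis
      using room[OF that] card_le_inj[of "Z r" "B - D - row r"] unfolding Z_def by meson
  qed
  then obtain g where g: "\<And>r. r \<in> A \<Longrightarrow> inj_on (g r) (Z r)"
    "\<And>r. r \<in> A \<Longrightarrow> g r ` Z r \<subseteq> B - D - row r"
    by metis
  define \<phi> where "\<phi> z = (if snd z \<in> D then (fst z, g (fst z) (snd z)) else z)" for z
  define F where "F i = (if i \<in> K then E i else \<beta> i \<union> \<phi> ` \<beta> i)" for i
  \<comment> \<open>If \<open>i \<in> K\<close>, then \<open>E i\<close> adds cells only in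
    \<open>D\<close>, and this trace is the part of the block left behind as an obstacle.\<close>
  define \<gamma> where "\<gamma> i = F i \<inter> A \<times> (B - D)" for i
  \<comment> \<open>The marks that disappear; there are at least \<open>card D\<close> of them,
    which pays for the lost columns in the bound \<open>few\<close>.\<close>
  define X where "X = (\<Union>i\<in>K. \<beta> i) \<inter> A \<times> D"
  have \<phi>_move: "\<phi> z \<in> A \<times> (B - D) \<and> \<phi> z \<notin> marks \<and> fst (\<phi> z) = fst z"
    if "i \<in> I - K" "z \<in> \<beta> i" "snd z \<in> D" for i z
  proof -
    have "fst z \<in> A" "snd z \<in> Z (fst z)"
      using that sub unfolding Z_def by (force, force)
    then have "g (fst z) (snd z) \<in> B - D - row (fst z)"
      using g(2) by blast
    then show ?thesis
      using that(3) \<open>fst z \<in> A\<close> unfolding \<phi>_def row_def by auto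
  qed
  have \<phi>_in: "\<phi> z \<in> A \<times> (B - D)" if "i \<in> I - K" "z \<in> \<beta> i" for i z
  proof (cases "snd z \<in> D")
    case False
    then show ?thesis
      using that sub unfolding \<phi>_def by fastforce
  qed (use \<phi>_move that in blast)
  have \<phi>_inj: "z = z'"
    if "i \<in> I - K" "z \<in> \<beta> i" "j \<in> I - K" "z' \<in> \<beta> j" "\<phi> z = \<phi> z'" for i j z z'
  proof (cases "snd z \<in> D")
    case True
    have "snd z' \<in> D"
    proof (rule ccontr)
      assume "snd z' \<notin> D"
      then have "\<phi> z = z'"
        using that(5) by (simp add: \<phi>_def)
      then show False
        using \<phi>_move[OF that(1,2) True] that(3,4) by blast
    qed
    have r: "fst z = fst z'"
      using that(5) True \<open>snd z' \<in> D\<close> by (simp add: \<phi>_def)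
    have "fst z \<in> A" "snd z \<in> Z (fst z)" "snd z' \<in> Z (fst z)"
      using that True \<open>snd z' \<in> D\<close> r sub unfolding Z_def by (force, force, metis (no_types, lifting) UN_I mem_Collect_eq prod.collapse)
    moreover have "g (fst z) (snd z) = g (fst z) (snd z')"
      using that(5) True \<open>snd z' \<in> D\<close> r by (simp add: \<phi>_def)
    ultimately have "snd z = snd z'"
      using g(1) by (meson inj_onD)
    then show ?thesis
      using r by (simp add: prod_eq_iff)
  next
    case False
    then show ?thesis
      using that \<phi>_move[OF that(3,4)] unfolding \<phi>_def by (metis UN_I DiffD1)
  qed
  have F_sub: "F i \<subseteq> A \<times> B" if "i \<in> I" for i
  proof (cases "i \<in> K")
    case True
    then show ?thesis
      using E[of i] sub[OF that] D unfolding F_def by auto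
  next
    case False
    have "\<phi> ` \<beta> i \<subseteq> A \<times> (B - D)"
      using \<phi>_in[of i] that False by blast
    then show ?thesis
      using sub[OF that] False unfolding F_def by auto
  qed
  have F_block: "\<beta> i \<subseteq> F i" if "i \<in> I" for i
    using that E[of i] unfolding F_def by auto
  have E_phi: "E i \<inter> \<phi> ` \<beta> j = {}" if "i \<in> K" "j \<in> I - K" for i j
  proof -
    have "\<phi> z \<notin> E i" if "z \<in> \<beta> j" for z
    proof (cases "snd z \<in> D")
      case True
      then have "\<phi> z \<notin> marks" "\<phi> z \<notin> A \<times> D"
        using \<phi>_move[OF \<open>j \<in> I - K\<close> that] by auto
      moreover have "\<beta> i \<subseteq> marks"
        using \<open>i \<in> K\<close> K by (intro UN_upper) auto
      ultimately show ?thesis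
        using conjunct1[OF conjunct2[OF E[OF \<open>i \<in> K\<close>]]] by (metis UnE subsetD)
    next
      case False
      then show ?thesis
        using E_other[OF \<open>i \<in> K\<close> \<open>j \<in> I - K\<close>] that unfolding \<phi>_def by auto
    qed
    then show ?thesis by blast
  qed
  have F_disj: "F i \<inter> F j = {}" if ij: "i \<in> I" "j \<in> I" "i \<noteq> j" for i j
  proof -
    have *: "\<beta> i \<inter> \<beta> j = {}"
      using disj ij unfolding disjoint_family_on_def by blast
    consider "i \<in> K" "j \<in> K" | "i \<in> K" "j \<notin> K" | "i \<notin> K" "j \<in> K" | "i \<notin> K" "j \<notin> K"
      by blast
    then show ?thesis
    proof cases
      case 1
      then show ?thesis
        using E_disj ij unfolding F_def disjoint_family_on_def by auto
    next
      case 2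
      then show ?thesis
        using E_other[of i j] E_phi[of i j] ij unfolding F_def by auto
    next
      case 3
      then show ?thesis
        using E_other[of j i] E_phi[of j i] ij unfolding F_def by auto
    next
      case 4
      have "\<phi> z \<noteq> z'" if "z \<in> \<beta> i" "z' \<in> \<beta> j" for z z'
      proof
        assume "\<phi> z = z'"
        then show False
          using that * \<phi>_move[of i z] 4 ij unfolding \<phi>_def by (cases "snd z \<in> D") auto
      qed
      moreover have "\<phi> z \<noteq> z'" if "z \<in> \<beta> j" "z' \<in> \<beta> i" for z z'
      proof
        assume "\<phi> z = z'"
        then show False
          using that * \<phi>_move[of j z] 4 ij unfolding \<phi>_def by (cases "snd z \<in> D") auto
      qed
      moreover have "\<phi> z \<noteq> \<phi> z'" if "z \<in> \<beta> i" "z' \<in> \<beta> j" for z z'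
        using \<phi>_inj[of i z j z'] that * 4 ij by auto
      ultimately have "(\<beta> i \<union> \<phi> ` \<beta> i) \<inter> (\<beta> j \<union> \<phi> ` \<beta> j) = {}"
        using * by blast
      then show ?thesis
        using 4 unfolding F_def by simp
    qed
  qed
  have \<gamma>_sub: "\<gamma> i \<subseteq> \<phi> ` (\<beta> i - X)" if "i \<in> I" for i
  proof
    fix y assume y: "y \<in> \<gamma> i"
    show "y \<in> \<phi> ` (\<beta> i - X)"
    proof (cases "i \<in> K")
      case True
      then have "y \<in> \<beta> i" "snd y \<notin> D"
        using y E[OF True] unfolding \<gamma>_def F_def by auto
      then show ?thesis
        unfolding \<phi>_def X_def by (intro image_eqI[of _ _ y]) auto
    next
      case False
      have X: "\<beta> i \<inter> X = {}"
        using False that K block_eq unfolding X_def by blast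
      show ?thesis
      proof (cases "y \<in> \<beta> i")
        case True
        then have "snd y \<notin> D"
          using y unfolding \<gamma>_def by auto
        then show ?thesis
          using X True unfolding \<phi>_def by (intro image_eqI[of _ _ y]) auto
      next
        assume "y \<notin> \<beta> i"
        then have "y \<in> \<phi> ` \<beta> i"
          using y False unfolding \<gamma>_def F_def by auto
        then show ?thesis
          using X by blast
      qed
    qed
  qed
  have "rook_blocks A (B - D) I \<gamma>"
  proof
    show "disjoint_family_on \<gamma> I"
      using F_disj unfolding \<gamma>_def disjoint_family_on_def by blast
    show "\<gamma> i \<subseteq> A \<times> (B - D)" for i
      unfolding \<gamma>_def by blast
    show "card (\<gamma> i) \<le> 2" if "i \<in> I" for i
    proof -
      have "card (\<gamma> i) \<le> card (\<phi> ` (\<beta> i - X))"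
        using \<gamma>_sub that finite_block by (intro card_mono) auto
      also have "\<dots> \<le> card (\<beta> i - X)"
        using that finite_block by (intro card_image_le) auto
      also have "\<dots> \<le> card (\<beta> i)"
        using that finite_block by (intro card_mono) auto
      finally show ?thesis
        using card2[OF that] by simp
    qed
    have X: "X \<subseteq> marks"
      using K unfolding X_def by (intro le_infI1 UN_mono) auto
    have "card (\<Union>i\<in>I. \<gamma> i) \<le> card (\<phi> ` (marks - X))"
    proof (rule card_mono)
      show "(\<Union>i\<in>I. \<gamma> i) \<subseteq> \<phi> ` (marks - X)"
        using \<gamma>_sub by (intro UN_least) (meson Diff_mono UN_upper equalityE image_mono subset_trans)
    qed (use finite_marks in auto)
    also have "\<dots> \<le> card (marks - X)"
      using finite_marks by (intro card_image_le) auto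
    also have "\<dots> = card marks - card X"
      using X finite_subset[OF X finite_marks] by (intro card_Diff_subset)
    finally have "card (\<Union>i\<in>I. \<gamma> i) \<le> card marks - card X" .
    moreover have "card X \<le> card marks"
      using X finite_marks by (intro card_mono)
    moreover have "card (B - D) = card B - card D" "card D \<le> card B"
      using D fin by (simp_all add: card_Diff_subset card_mono finite_subset)
    ultimately show "card (\<Union>i\<in>I. \<gamma> i) + 2 \<le> card A + card (B - D)"
      using few kill unfolding X_def by linarith
  qed (use fin in auto)
  from IH[OF this] obtain C where C: "disjoint_family_on C I"
    "\<And>i. i \<in> I \<Longrightarrow> \<gamma> i \<subseteq> C i \<and> C i \<subseteq> A \<times> (B - D) \<and> joined (C i) (\<gamma> i)"
    unfolding linkable_def by meson
  \<comment> \<open>Outside \<open>D\<close>, \<open>F i\<close> is the trace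
    \<open>\<gamma> i\<close> and lies in \<open>C i\<close>; inside \<open>D\<close>, there is
    nothing of \<open>C j\<close>.\<close>
  have FC: "F i \<inter> C j = {}" if "i \<in> I" "j \<in> I" "i \<noteq> j" for i j
  proof -
    have "F i \<inter> C j \<subseteq> C i \<inter> C j"
    proof
      fix z assume z: "z \<in> F i \<inter> C j"
      then have "z \<in> \<gamma> i"
        using C(2)[OF that(2)] unfolding \<gamma>_def by blast
      then show "z \<in> C i \<inter> C j"
        using C(2)[OF that(1)] z by blast
    qed
    then show ?thesis
      using C(1) that unfolding disjoint_family_on_def by blast
  qed
  have "joined (F i \<union> C i) (\<beta> i)" if i: "i \<in> I" for i
  proof (cases "i \<in> K")
    case True
    then show ?thesis
      using E[OF True] unfolding F_def by (auto intro: joined_mono)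
  next
    case False
    show ?thesis
    proof (rule joined_via)
      show "joined (F i \<union> C i) (\<gamma> i)"
        using C(2)[OF i] by (auto intro: joined_mono)
      fix z assume z: "z \<in> \<beta> i"
      have "\<phi> z \<in> \<gamma> i"
        using \<phi>_in[of i z] z i False unfolding \<gamma>_def F_def by auto
      moreover have "(z, \<phi> z) \<in> rook"
        unfolding rook_def \<phi>_def by auto
      ultimately show "\<exists>h\<in>\<gamma> i. (z, h) \<in> (rook \<inter> (F i \<union> C i) \<times> (F i \<union> C i))\<^sup>*"
        using F_block[OF i] z unfolding \<gamma>_def by (intro bexI[of _ "\<phi> z"] r_into_rtrancl) auto
    qed
  qed
  moreover have "disjoint_family_on (\<lambda>i. F i \<union> C i) I"
    using F_disj FC C(1) unfolding disjoint_family_on_def by blast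
  ultimately show ?thesis
    unfolding linkable_def
  proof (intro exI[of _ "\<lambda>i. F i \<union> C i"] conjI ballI)
    fix i assume "i \<in> I"
    then show "\<beta> i \<subseteq> F i \<union> C i" "F i \<union> C i \<subseteq> A \<times> B"
      using F_block F_sub C(2) by (blast, blast)
  qed blast+
qed

end

text \<open>Pairwise meeting pairs form a star or a triangle, and a triangle has only three
  points.\<close>

lemma common_element_of_pairs:
  assumes pair: "\<And>i. i \<in> J \<Longrightarrow> card (S i) = 2"
    and meet: "\<And>i j. i \<in> J \<Longrightarrow> j \<in> J \<Longrightarrow> S i \<inter> S j \<noteq> {}"
    and large: "card (\<Union>i\<in>J. S i) \<ge> 4"
  shows "\<exists>x. \<forall>i\<in>J. x \<in> S i"
proof (rule ccontr)
  assume no: "\<nexists>x. \<forall>i\<in>J. x \<in> S i"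
  have "J \<noteq> {}"
    using large by auto
  then obtain i where i: "i \<in> J" by blast
  obtain x y where xy: "S i = {x, y}" "x \<noteq> y"
    using pair[OF i] by (auto simp: card_2_iff)
  obtain j where j: "j \<in> J" "x \<notin> S j"
    using no by blast
  have "y \<in> S j"
    using meet[OF i j(1)] j(2) xy by auto
  then obtain z where z: "S j = {y, z}" "z \<noteq> y"
    using pair[OF j(1)] unfolding card_2_iff by fastforce
  obtain l where l: "l \<in> J" "y \<notin> S l"
    using no by blast
  have "x \<in> S l" "z \<in> S l"
    using meet[OF i l(1)] meet[OF j(1) l(1)] l(2) xy z by auto
  then have Sl: "S l = {x, z}"
    using pair[OF l(1)] j(2) z unfolding card_2_iff by auto
  have "S m \<subseteq> {x, y, z}" if m: "m \<in> J" for m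
    using meet[OF i m] meet[OF j(1) m] meet[OF l(1) m] pair[OF m] xy z Sl j(2)
    unfolding card_2_iff by auto
  then have "card (\<Union>i\<in>J. S i) \<le> card {x, y, z}"
    by (intro card_mono) auto
  also have "\<dots> \<le> 3"
    by (simp add: card_insert_le_m1)
  finally show False
    using large by simp
qed

text \<open>The elements outside \<open>T\<close> contribute at least two each. With small
  \<open>T\<close> this bounds the marks in a few chosen lines by the total.\<close>

lemma sum_ge_2_card:
  fixes g :: "'x \<Rightarrow> nat"
  assumes "finite S" "T \<subseteq> S" "\<And>x. x \<in> S \<Longrightarrow> 2 \<le> g x"
  shows "sum g T + 2 * card S \<le> sum g S + 2 * card T"
proof -
  have "sum g S = sum g T + sum g (S - T)"
    using assms by (simp add: sum.subset_diff)
  moreover have "2 * card (S - T) \<le> sum g (S - T)"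
    using assms sum_mono[of "S - T" "\<lambda>_. 2" g] by simp
  moreover have "card S = card T + card (S - T)"
    using assms by (metis card_Diff_subset card_mono finite_subset le_add_diff_inverse)
  ultimately show ?thesis by simp
qed

section \<open>Counting marked cells line by line\<close>

context rook_blocks
begin

definition nonempty_cols :: "'b set" where
  "nonempty_cols = {c \<in> B. col c \<noteq> {}}"

definition nonempty_rows :: "'a set" where
  "nonempty_rows = {r \<in> A. row r \<noteq> {}}"

text \<open>Deletions keep the index set \<open>I\<close> and may empty blocks; only nonempty blocks
  are counted.\<close>

definition blocks :: "'i set" where
  "blocks = {i \<in> I. \<beta> i \<noteq> {}}"

lemma finite_nonempty: "finite nonempty_cols" "finite nonempty_rows" "finite blocks"
  using fin unfolding nonempty_cols_def nonempty_rows_def blocks_def by auto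

lemma col_sub: "col c \<subseteq> A" and row_sub: "row r \<subseteq> B"
  using marks_sub unfolding col_def row_def by auto

lemma finite_col: "finite (col c)" and finite_row: "finite (row r)"
  using finite_subset[OF col_sub fin(1)] finite_subset[OF row_sub fin(2)] .

lemma in_col: "r \<in> col c \<longleftrightarrow> (\<exists>i\<in>I. (r, c) \<in> \<beta> i)"
  and in_row: "c \<in> row r \<longleftrightarrow> (\<exists>i\<in>I. (r, c) \<in> \<beta> i)"
  unfolding col_def row_def by auto

lemma card_marks_cols: "card marks = (\<Sum>c\<in>nonempty_cols. card (col c))"
proof -
  have "(r, c) \<in> marks \<longleftrightarrow> c \<in> nonempty_cols \<and> r \<in> col c" for r c
    using marks_sub unfolding nonempty_cols_def col_def by blast
  then have "marks = prod.swap ` (SIGMA c:nonempty_cols. col c)"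
    by (simp del: UN_iff add: set_eq_iff image_iff)
  moreover have "inj_on prod.swap (SIGMA c:nonempty_cols. col c)"
    by (auto simp: inj_on_def)
  ultimately have "card marks = card (SIGMA c:nonempty_cols. col c)"
    by (metis card_image)
  then show ?thesis
    using finite_nonempty finite_col by simp
qed

lemma card_marks_rows: "card marks = (\<Sum>r\<in>nonempty_rows. card (row r))"
proof -
  have "(r, c) \<in> marks \<longleftrightarrow> r \<in> nonempty_rows \<and> c \<in> row r" for r c
    using marks_sub unfolding nonempty_rows_def row_def by blast
  then have "marks = (SIGMA r:nonempty_rows. row r)"
    by (simp del: UN_iff add: set_eq_iff)
  then show ?thesis
    using finite_nonempty finite_row by simp
qed

text \<open>An injection \<open>g\<close> gives each block an empty line of its own, through whose
  crossings it is linked.\<close>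

lemma linkable_if_many_empty_lines:
  assumes "card blocks \<le> card (A - nonempty_rows) + card (B - nonempty_cols)"
  shows "linkable A B I \<beta>"
proof -
  let ?L = "(A - nonempty_rows) <+> (B - nonempty_cols)"
  have "finite ?L" "card blocks \<le> card ?L"
    using assms fin by (auto simp: card_Plus)
  then obtain g where g: "inj_on g blocks" "g ` blocks \<subseteq> ?L"
    using card_le_inj finite_nonempty by meson
  define C where "C i = (if \<beta> i = {} then {} else case g i of
      Inl r \<Rightarrow> \<beta> i \<union> {r} \<times> snd ` \<beta> i | Inr c \<Rightarrow> \<beta> i \<union> fst ` \<beta> i \<times> {c})" for i
  have new: "C i \<inter> marks = \<beta> i" if "i \<in> I" for i
  proof (cases "\<beta> i = {}")
    case False
    then have "g i \<in> ?L"
      using g(2) that unfolding blocks_def by blast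
    then consider r where "g i = Inl r" "r \<in> A - nonempty_rows"
      | c where "g i = Inr c" "c \<in> B - nonempty_cols"
      by blast
    then show ?thesis
    proof cases
      case 1
      then have "{r} \<times> snd ` \<beta> i \<inter> marks = {}"
        unfolding nonempty_rows_def row_def by blast
      then show ?thesis
        using 1 False that unfolding C_def by auto
    next
      case 2
      then have "fst ` \<beta> i \<times> {c} \<inter> marks = {}"
        unfolding nonempty_cols_def col_def by blast
      then show ?thesis
        using 2 False that unfolding C_def by auto
    qed
  qed (simp add: C_def)
  \<comment> \<open>An empty row is entered only in nonempty columns, and an empty column only in
    nonempty rows. So an added cell determines the line it lies on, and links through different
    lines do not cross.\<close>
  have line: "(fst z \<in> A - nonempty_rows \<and> g i = Inl (fst z) \<and> snd z \<in> nonempty_cols) \<or>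
      (snd z \<in> B - nonempty_cols \<and> g i = Inr (snd z) \<and> fst z \<in> nonempty_rows)"
    if "i \<in> I" "z \<in> C i" "z \<notin> \<beta> i" for i z
  proof -
    have ne: "\<beta> i \<noteq> {}"
      using that unfolding C_def by auto
    then have "g i \<in> ?L"
      using that(1) g(2) unfolding blocks_def by blast
    moreover have "c \<in> nonempty_cols" "r \<in> nonempty_rows" if "(r, c) \<in> \<beta> i" for r c
      using sub[OF \<open>i \<in> I\<close>] that \<open>i \<in> I\<close>
      unfolding nonempty_cols_def nonempty_rows_def col_def row_def by blast+
    ultimately show ?thesis
      using that(2,3) ne unfolding C_def by auto
  qed
  have "C i \<inter> C j = {}" if "i \<in> I" "j \<in> I" "i \<noteq> j" for i j
  proof (rule ccontr)
    assume "C i \<inter> C j \<noteq> {}"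
    then obtain z where z: "z \<in> C i" "z \<in> C j" by blast
    have "z \<notin> marks"
      using z new that block_eq by blast
    then have "z \<notin> \<beta> i" "z \<notin> \<beta> j"
      using that by auto
    then have "g i = g j"
      using line[OF that(1) z(1)] line[OF that(2) z(2)] by auto
    moreover have "i \<in> blocks" "j \<in> blocks"
      using z that unfolding C_def blocks_def by auto
    ultimately show False
      using g(1) that(3) by (meson inj_onD)
  qed
  moreover have "\<beta> i \<subseteq> C i \<and> C i \<subseteq> A \<times> B \<and> joined (C i) (\<beta> i)" if "i \<in> I" for i
  proof (intro conjI)
    show "\<beta> i \<subseteq> C i"
      using new[OF that] by blast
    show "C i \<subseteq> A \<times> B"
    proof
      fix z assume z: "z \<in> C i"
      show "z \<in> A \<times> B"
      proof (cases "z \<in> \<beta> i")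
        case False
        then show ?thesis
          using line[OF that z] unfolding nonempty_cols_def nonempty_rows_def mem_Times_iff by blast
      qed (use sub that in blast)
    qed
    show "joined (C i) (\<beta> i)"
      using joined_column[of "\<beta> i"] joined_row[of "\<beta> i"]
      by (auto simp: C_def joined_def split: sum.split)
  qed
  ultimately have "disjoint_family_on C I \<and>
      (\<forall>i\<in>I. \<beta> i \<subseteq> C i \<and> C i \<subseteq> A \<times> B \<and> joined (C i) (\<beta> i))"
    by (simp add: disjoint_family_on_def)
  then show ?thesis
    unfolding linkable_def by (rule exI[of _ C])
qed

end

subsection \<open>Instances admitting no deletion\<close>

text \<open>A minimal counterexample with at least as many columns as rows. Only columns are deleted
  here, so \<open>IH\<close> speaks of fewer columns.\<close>

locale stuck_blocks = rook_blocks A B I \<beta>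
  for A :: "'a set" and B :: "'b set" and I :: "'i set" and \<beta> +
  assumes le: "card A \<le> card B"
    and IH: "\<And>B' \<gamma>. B' \<subset> B \<Longrightarrow> rook_blocks A B' I \<gamma> \<Longrightarrow> linkable A B' I \<gamma>"
    and stuck: "\<not> linkable A B I \<beta>"
begin

text \<open>Contrapositive of \<open>delete_columns\<close>: a deletion meeting all other
  requirements must fail for lack of room in some row.\<close>

lemma no_deletion:
  assumes "D \<subseteq> B" "D \<noteq> {}" "K \<subseteq> I"
    and "\<And>i. i \<in> K \<Longrightarrow> \<beta> i \<subseteq> E i \<and> E i \<subseteq> \<beta> i \<union> A \<times> D \<and> joined (E i) (\<beta> i)"
    and "disjoint_family_on E K"
    and "\<And>i j. i \<in> K \<Longrightarrow> j \<in> I - K \<Longrightarrow> E i \<inter> \<beta> j = {}"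
    and "card D \<le> card ((\<Union>i\<in>K. \<beta> i) \<inter> A \<times> D)"
  shows "\<exists>r\<in>A. card (B - D - row r) < card {c \<in> D. (r, c) \<in> (\<Union>i\<in>I - K. \<beta> i)}"
proof -
  have "B - D \<subset> B"
    using assms(1,2) by blast
  then have "linkable A (B - D) I \<gamma>" if "rook_blocks A (B - D) I \<gamma>" for \<gamma>
    using IH that by blast
  then show ?thesis
    using delete_columns[OF assms(1,3-7)] stuck by (meson not_le)
qed

text \<open>A column \<open>c\<close> with a lone mark could be deleted: the block of this mark is
  linked through \<open>c\<close>, one mark disappears, and no cell has to move.\<close>

lemma card_col_neq_1: "card (col c) \<noteq> 1"
proof
  assume "card (col c) = 1"
  then obtain r where r: "col c = {r}"
    by (auto simp: card_1_singleton_iff)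
  then obtain i where i: "i \<in> I" "(r, c) \<in> \<beta> i"
    using in_col by blast
  have c: "c \<in> B"
    using i sub by blast
  have other: "(x, c) \<notin> \<beta> j" if "j \<in> I - {i}" for x j
  proof
    assume *: "(x, c) \<in> \<beta> j"
    then have "x = r"
      using that r in_col[of x c] by blast
    then show False
      using * that i block_eq by blast
  qed
  have "\<exists>x\<in>A. card (B - {c} - row x) < card {c' \<in> {c}. (x, c') \<in> (\<Union>j\<in>I - {i}. \<beta> j)}"
  proof (rule no_deletion[of "{c}" "{i}" "\<lambda>_. \<beta> i \<union> fst ` \<beta> i \<times> {c}"])
    have "(\<Union>j\<in>{i}. \<beta> j) \<inter> A \<times> {c} \<noteq> {}"
      using i sub by auto
    then show "card {c} \<le> card ((\<Union>j\<in>{i}. \<beta> j) \<inter> A \<times> {c})"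
      using i finite_block[of i] by (simp add: Suc_le_eq card_gt_0_iff)
    show "\<beta> i' \<subseteq> \<beta> i \<union> fst ` \<beta> i \<times> {c} \<and> \<beta> i \<union> fst ` \<beta> i \<times> {c} \<subseteq> \<beta> i' \<union> A \<times> {c} \<and>
        joined (\<beta> i \<union> fst ` \<beta> i \<times> {c}) (\<beta> i')" if "i' \<in> {i}" for i'
      using that sub[OF i(1)] joined_column[of "\<beta> i"] by auto
  qed (use c i other block_eq in \<open>auto simp: disjoint_family_on_def\<close>)
  then obtain x where x: "card (B - {c} - row x) < card {c' \<in> {c}. (x, c') \<in> (\<Union>j\<in>I - {i}. \<beta> j)}"
    by blast
  have "{c' \<in> {c}. (x, c') \<in> (\<Union>j\<in>I - {i}. \<beta> j)} = {}"
    using other by blast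
  then show False
    using x by (metis card.empty not_less_zero)
qed

lemma card_col_ge_2: "c \<in> nonempty_cols \<Longrightarrow> 2 \<le> card (col c)"
  using card_col_neq_1[of c] finite_col[of c] unfolding nonempty_cols_def
  by (metis (mono_tags, lifting) One_nat_def card_0_eq less_2_cases mem_Collect_eq not_le)

lemma cols_count:
  "T \<subseteq> nonempty_cols \<Longrightarrow> (\<Sum>c\<in>T. card (col c)) + 2 * card nonempty_cols \<le> card marks + 2 * card T"
  unfolding card_marks_cols by (rule sum_ge_2_card[OF finite_nonempty(1) _ card_col_ge_2])

text \<open>Otherwise there are at least \<open>2 * card B\<close> marks, two per column, while
  \<open>few\<close> and \<open>le\<close> allow at most \<open>2 * card B - 2\<close>.\<close>

lemma empty_col_exists: "B - nonempty_cols \<noteq> {}"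
proof
  assume "B - nonempty_cols = {}"
  then have "nonempty_cols = B"
    unfolding nonempty_cols_def by blast
  then show False
    using cols_count[of "{}"] few le by simp
qed

text \<open>With slack in \<open>few\<close>, an empty column could be dropped without removing any
  mark.\<close>

lemma tight: "card marks + 2 = card A + card B"
proof (rule ccontr)
  assume *: "card marks + 2 \<noteq> card A + card B"
  obtain f where f: "f \<in> B" "col f = {}"
    using empty_col_exists unfolding nonempty_cols_def by blast
  have "rook_blocks A (B - {f}) I \<beta>"
  proof
    show "\<beta> i \<subseteq> A \<times> (B - {f})" if "i \<in> I" for i
      using sub[OF that] f(2) that unfolding col_def by blast
    show "card marks + 2 \<le> card A + card (B - {f})"
      using * few f(1) fin by simp
  qed (use fin disj card2 in auto)
  then have "linkable A (B - {f}) I \<beta>"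
    using IH f(1) by blast
  then have "linkable A B I \<beta>"
    unfolding linkable_def by blast
  then show False
    using stuck by blast
qed

section \<open>Structure forced by the failure of deletions\<close>

lemma card_empty_cols: "card (B - nonempty_cols) + card nonempty_cols = card B"
  using fin card_mono[of B nonempty_cols]
  by (subst card_Diff_subset) (auto simp: nonempty_cols_def)

text \<open>The empty columns other than \<open>f\<close> lie outside \<open>D\<close>, and each of
  them offers a free place in every row.\<close>

lemma free_cells:
  assumes "f \<in> B" "col f = {}" "f \<in> D" "D - {f} \<subseteq> nonempty_cols"
  shows "card (B - nonempty_cols) \<le> card (B - D - row r) + 1"
proof -
  have "B - nonempty_cols - {f} \<subseteq> B - D - row r"
    using assms(3,4) unfolding nonempty_cols_def col_def row_def by blast
  then have "card (B - nonempty_cols - {f}) \<le> card (B - D - row r)"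
    using fin by (intro card_mono) auto
  moreover have "f \<in> B - nonempty_cols"
    using assms(1,2) unfolding nonempty_cols_def by simp
  ultimately show ?thesis
    using fin by (simp add: card_Diff_singleton)
qed

text \<open>By \<open>tight\<close> and \<open>le\<close> there are at most
  \<open>2 * card nonempty_cols\<close> marks, so no column can exceed its two.\<close>

lemma card_col_if_one_empty_col:
  assumes "card (B - nonempty_cols) = 1" "c \<in> nonempty_cols"
  shows "card (col c) = 2"
  using cols_count[of "{c}"] assms card_empty_cols tight le card_col_ge_2[OF assms(2)] by simp

text \<open>Deleting \<open>c\<close> and the empty column \<open>f\<close> removes the two marks in
  \<open>c\<close>. Each row has at most one cell to move, for which a second empty column gives
  room. Without one, \<open>c\<close> holds only the two removed marks and nothing moves.\<close>

lemma no_two_kills: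
  assumes f: "f \<in> B" "col f = {}"
    and ij: "i \<in> I" "j \<in> I" "i \<noteq> j" "(r, c) \<in> \<beta> i" "(s, c) \<in> \<beta> j"
    and Ei: "\<beta> i \<subseteq> Ei" "Ei \<subseteq> \<beta> i \<union> A \<times> {c, f}" "joined Ei (\<beta> i)"
    and Ej: "\<beta> j \<subseteq> Ej" "Ej \<subseteq> \<beta> j \<union> A \<times> {c, f}" "joined Ej (\<beta> j)"
    and d: "Ei \<inter> Ej = {}" "\<And>l. l \<in> I - {i, j} \<Longrightarrow> (Ei \<union> Ej) \<inter> \<beta> l = {}"
  shows False
proof -
  have c: "c \<in> nonempty_cols" "c \<in> B"
    using ij sub[OF ij(1)] unfolding nonempty_cols_def col_def by auto
  have "c \<noteq> f" "r \<noteq> s"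
    using ij f(2) block_eq[OF ij(1,2)] unfolding col_def by auto
  have "\<exists>x\<in>A. card (B - {c, f} - row x) < card {c' \<in> {c, f}. (x, c') \<in> (\<Union>l\<in>I - {i, j}. \<beta> l)}"
  proof (rule no_deletion[of "{c, f}" "{i, j}" "\<lambda>l. if l = i then Ei else Ej"])
    have "{(r, c), (s, c)} \<subseteq> (\<Union>l\<in>{i, j}. \<beta> l) \<inter> A \<times> {c, f}"
      using ij sub by auto
    then have "card {(r, c), (s, c)} \<le> card ((\<Union>l\<in>{i, j}. \<beta> l) \<inter> A \<times> {c, f})"
      using ij finite_block by (intro card_mono) auto
    then show "card {c, f} \<le> card ((\<Union>l\<in>{i, j}. \<beta> l) \<inter> A \<times> {c, f})"
      using \<open>c \<noteq> f\<close> \<open>r \<noteq> s\<close> by simp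
    show "disjoint_family_on (\<lambda>l. if l = i then Ei else Ej) {i, j}"
      using d(1) by (auto simp: disjoint_family_on_def)
    show "(if l = i then Ei else Ej) \<inter> \<beta> m = {}" if "l \<in> {i, j}" "m \<in> I - {i, j}" for l m
      using d(2)[OF that(2)] by auto
  qed (use f c ij Ei Ej in auto)
  then obtain x where
    x: "card (B - {c, f} - row x) < card {c' \<in> {c, f}. (x, c') \<in> (\<Union>l\<in>I - {i, j}. \<beta> l)}"
    by blast
  have *: "{c' \<in> {c, f}. (x, c') \<in> (\<Union>l\<in>I - {i, j}. \<beta> l)} \<subseteq> {c}"
    using f(2) unfolding col_def by auto
  then have "card {c' \<in> {c, f}. (x, c') \<in> (\<Union>l\<in>I - {i, j}. \<beta> l)} \<le> 1"
    using card_mono[OF _ *] by simp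
  with x have "card (B - {c, f} - row x) = 0"
    by linarith
  have ne: "{c' \<in> {c, f}. (x, c') \<in> (\<Union>l\<in>I - {i, j}. \<beta> l)} \<noteq> {}"
    using x by (metis card.empty not_less_zero)
  then have "card (B - nonempty_cols) \<le> 1"
    using free_cells[OF f, of "{c, f}" x] c \<open>card (B - {c, f} - row x) = 0\<close> by auto
  then have "card (col c) = 2"
    using card_col_if_one_empty_col[OF _ c(1)] empty_col_exists fin
    by (metis card_0_eq finite_Diff le_antisym less_one not_le)
  moreover obtain l where l: "l \<in> I - {i, j}" "(x, c) \<in> \<beta> l"
    using ne * by blast
  have "x \<noteq> r" "x \<noteq> s"
    using l ij block_eq by (metis DiffE insertCI)+
  then have "card {x, r, s} = 3"
    using \<open>r \<noteq> s\<close> by simp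
  moreover have "{x, r, s} \<subseteq> col c"
    using l ij in_col by blast
  ultimately show False
    using card_mono[OF finite_col, of "{x, r, s}" c] by simp
qed

text \<open>Otherwise \<open>i\<close> can be linked through \<open>c\<close>. If another block
  meets \<open>c\<close>, it is linked through the empty column \<open>f\<close>, against
  \<open>no_two_kills\<close>. If not, all marks in \<open>c\<close>, at least two, belong to
  \<open>i\<close>, and \<open>c\<close> and \<open>f\<close> can be deleted without moving any
  cell.\<close>

lemma crossing_cell_marked:
  assumes i: "i \<in> I" "(r, c) \<in> \<beta> i"
  shows "\<exists>\<rho>\<in>fst ` \<beta> i. \<exists>j\<in>I - {i}. (\<rho>, c) \<in> \<beta> j"
proof (rule ccontr)
  assume no: "\<not> ?thesis"
  obtain f where f: "f \<in> B" "col f = {}"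
    using empty_col_exists unfolding nonempty_cols_def by blast
  have c: "c \<in> nonempty_cols" "c \<in> B" "c \<noteq> f"
    using i sub[OF i(1)] f(2) unfolding nonempty_cols_def col_def by auto
  let ?Ei = "\<beta> i \<union> fst ` \<beta> i \<times> {c}"
  have free: "?Ei \<inter> \<beta> l = {}" if "l \<in> I - {i}" for l
    using no that i(1) block_eq[of i l] by blast
  have f_new: "(x, f) \<notin> \<beta> l" if "l \<in> I" for x l
    using f(2) that unfolding col_def by blast
  show False
  proof (cases "\<exists>j\<in>I - {i}. \<exists>s. (s, c) \<in> \<beta> j")
    case True
    then obtain j s where j: "j \<in> I" "i \<noteq> j" "(s, c) \<in> \<beta> j"
      by blast
    let ?Ej = "\<beta> j \<union> fst ` \<beta> j \<times> {f}"
    show False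
    proof (rule no_two_kills[OF f i(1) j(1,2) i(2) j(3), of ?Ei ?Ej])
      show "?Ei \<inter> ?Ej = {}"
        using free[of j] j f_new[OF i(1)] c(3) by auto
      show "(?Ei \<union> ?Ej) \<inter> \<beta> l = {}" if "l \<in> I - {i, j}" for l
        using free[of l] that f_new[of l] block_eq[OF j(1), of l] by auto
    qed (use sub[OF i(1)] sub[OF j(1)] in \<open>auto intro: joined_column\<close>)
  next
    case False
    have "\<exists>x\<in>A. card (B - {c, f} - row x) < card {c' \<in> {c, f}. (x, c') \<in> (\<Union>l\<in>I - {i}. \<beta> l)}"
    proof (rule no_deletion[of "{c, f}" "{i}" "\<lambda>_. ?Ei"])
      have "(\<lambda>x. (x, c)) ` col c \<subseteq> (\<Union>l\<in>{i}. \<beta> l) \<inter> A \<times> {c, f}"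
        using False sub unfolding col_def by fastforce
      then have "card ((\<lambda>x. (x, c)) ` col c) \<le> card ((\<Union>l\<in>{i}. \<beta> l) \<inter> A \<times> {c, f})"
        using i(1) finite_block by (intro card_mono) auto
      then show "card {c, f} \<le> card ((\<Union>l\<in>{i}. \<beta> l) \<inter> A \<times> {c, f})"
        using card_col_ge_2[OF c(1)] c(3) by (simp add: card_image inj_on_def)
      show "\<beta> l \<subseteq> ?Ei \<and> ?Ei \<subseteq> \<beta> l \<union> A \<times> {c, f} \<and> joined ?Ei (\<beta> l)" if "l \<in> {i}" for l
        using that sub[OF i(1)] joined_column[of "\<beta> i" c] by auto
      show "?Ei \<inter> \<beta> m = {}" if "l \<in> {i}" "m \<in> I - {i}" for l m
        using free that by blast
    qed (use f c i in \<open>auto simp: disjoint_family_on_def\<close>)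
    moreover have "{c' \<in> {c, f}. (x, c') \<in> (\<Union>l\<in>I - {i}. \<beta> l)} = {}" for x
      using False f_new by blast
    ultimately show False
      by (metis card.empty not_less_zero)
  qed
qed

text \<open>Blocks without a common row cross the empty column \<open>f\<close> in different cells,
  so both could be linked through \<open>f\<close>, against \<open>no_two_kills\<close>.\<close>

lemma rows_meet:
  assumes "i \<in> I" "j \<in> I" "(r, c) \<in> \<beta> i" "(s, c) \<in> \<beta> j"
  shows "fst ` \<beta> i \<inter> fst ` \<beta> j \<noteq> {}"
proof
  assume no: "fst ` \<beta> i \<inter> fst ` \<beta> j = {}"
  then have "i \<noteq> j"
    using assms by auto
  obtain f where f: "f \<in> B" "col f = {}"
    using empty_col_exists unfolding nonempty_cols_def by blast
  have f_new: "(x, f) \<notin> \<beta> l" if "l \<in> I" for x l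
    using f(2) that unfolding col_def by blast
  let ?E = "\<lambda>l. \<beta> l \<union> fst ` \<beta> l \<times> {f}"
  show False
  proof (rule no_two_kills[OF f assms(1,2) \<open>i \<noteq> j\<close> assms(3,4), of "?E i" "?E j"])
    show "?E i \<inter> ?E j = {}"
    proof -
      have "\<beta> i \<inter> \<beta> j = {}"
        using block_eq[OF assms(1,2)] \<open>i \<noteq> j\<close> by blast
      moreover have "\<beta> l \<inter> X \<times> {f} = {}" if "l \<in> I" for l X
        using f_new[OF that] by auto
      ultimately show ?thesis
        using no assms(1,2) by (simp add: Int_Un_distrib Int_Un_distrib2 Times_Int_Times Int_commute)
    qed
    show "(?E i \<union> ?E j) \<inter> \<beta> l = {}" if "l \<in> I - {i, j}" for l
      using that f_new[of l] block_eq[OF assms(1), of l] block_eq[OF assms(2), of l] by auto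
  qed (use sub[OF assms(1)] sub[OF assms(2)] in \<open>auto intro: joined_column\<close>)
qed

text \<open>The foreign mark in column \<open>c\<close> lies in the row of a second cell of the
  block, which therefore differs in row and column. Applied to that cell,
  \<open>crossing_cell_marked\<close> gives the fourth corner.\<close>

lemma block_is_rectangle:
  assumes i: "i \<in> I" "(r, c) \<in> \<beta> i"
  obtains r' c' where "r \<noteq> r'" "c \<noteq> c'" "\<beta> i = {(r, c), (r', c')}"
    "\<exists>j\<in>I - {i}. (r', c) \<in> \<beta> j" "\<exists>j\<in>I - {i}. (r, c') \<in> \<beta> j"
proof -
  obtain r' c' j where j: "(r', c') \<in> \<beta> i" "j \<in> I - {i}" "(r', c) \<in> \<beta> j"
    using crossing_cell_marked[OF i] by (metis imageE prod.collapse)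
  have ne: "r \<noteq> r'" "c \<noteq> c'"
    using j i block_eq[OF i(1), of j] by auto
  have eq: "\<beta> i = {(r, c), (r', c')}"
    using card_seteq[OF finite_block[OF i(1)], of "{(r, c), (r', c')}"] card2[OF i(1)] i(2) j(1) ne by simp
  obtain l where l: "l \<in> I - {i}" "(r, c') \<in> \<beta> l"
    using crossing_cell_marked[OF i(1) j(1)] block_eq[OF i(1)] j(1) eq by auto
  show ?thesis
    using that[OF ne eq] j(2,3) l by blast
qed

lemma block_cases:
  assumes "i \<in> blocks"
  obtains r c r' c' where "r \<noteq> r'" "c \<noteq> c'" "\<beta> i = {(r, c), (r', c')}"
    "\<exists>j\<in>I - {i}. (r', c) \<in> \<beta> j" "\<exists>j\<in>I - {i}. (r, c') \<in> \<beta> j"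
proof -
  obtain r c where "i \<in> I" "(r, c) \<in> \<beta> i"
    using assms unfolding blocks_def by auto
  then show ?thesis
    by (rule block_is_rectangle) (rule that)
qed

lemma card_marks: "card marks = 2 * card blocks"
proof -
  have "marks = (\<Union>i\<in>blocks. \<beta> i)"
    unfolding blocks_def by auto
  also have "card \<dots> = (\<Sum>i\<in>blocks. card (\<beta> i))"
    using finite_nonempty(3) finite_block block_eq
    by (intro card_UN_disjoint) (auto simp: blocks_def)
  also have "\<dots> = (\<Sum>i\<in>blocks. 2)"
  proof (rule sum.cong)
    show "card (\<beta> i) = 2" if "i \<in> blocks" for i
      using that by (rule block_cases) simp
  qed simp
  finally show ?thesis by simp
qed

text \<open>By \<open>tight\<close> and \<open>card_marks\<close> there are
  \<open>2 * card blocks + 2\<close> lines, of which fewer than \<open>card blocks\<close> are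
  empty.\<close>

lemma many_nonempty_lines: "card nonempty_rows + card nonempty_cols \<ge> card blocks + 3"
proof -
  have "card (A - nonempty_rows) + card nonempty_rows = card A"
    using fin card_mono[of A nonempty_rows]
    by (subst card_Diff_subset) (auto simp: nonempty_rows_def)
  moreover have "card (A - nonempty_rows) + card (B - nonempty_cols) < card blocks"
    using linkable_if_many_empty_lines stuck by linarith
  ultimately show ?thesis
    using card_empty_cols tight card_marks by linarith
qed

text \<open>If a row \<open>r''\<close> misses both columns \<open>c\<close>, \<open>c'\<close> of the block \<open>i\<close>, then \<open>i\<close> is linked through that row, a second
  block \<open>j\<close> meeting these columns is linked through the empty column \<open>f\<close>, and \<open>c\<close>, \<open>c'\<close>, \<open>f\<close> are deleted.
  With at most two empty columns, \<open>j\<close> must be chosen so that the marked cells \<open>left j x\<close> that remain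
  in each row \<open>x\<close> can still move out.\<close>

lemma cols_cover:
  assumes i: "i \<in> I" "\<beta> i = {(r, c), (r', c')}" "r \<noteq> r'" "c \<noteq> c'"
    and j1: "j1 \<in> I - {i}" "(r', c) \<in> \<beta> j1" and j2: "j2 \<in> I - {i}" "(r, c') \<in> \<beta> j2"
  shows "A \<subseteq> col c \<union> col c'"
proof (rule ccontr)
  assume "\<not> A \<subseteq> col c \<union> col c'"
  then obtain r'' where r'': "r'' \<in> A" "r'' \<notin> col c" "r'' \<notin> col c'"
    by blast
  obtain f where f: "f \<in> B" "col f = {}"
    using empty_col_exists unfolding nonempty_cols_def by blast
  have f_new: "(x, f) \<notin> \<beta> l" if "l \<in> I" for x l
    using f(2) that unfolding col_def by blast
  have r''_new: "(r'', c) \<notin> \<beta> l" "(r'', c') \<notin> \<beta> l" if "l \<in> I" for l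
    using r'' that unfolding col_def by auto
  have in_cols: "r \<in> col c" "r' \<in> col c" "r \<in> col c'" "r' \<in> col c'"
    using i j1 j2 by (auto simp: in_col)
  have c: "c \<in> nonempty_cols" "c' \<in> nonempty_cols"
    using in_cols i(1,2) sub[OF i(1)] unfolding nonempty_cols_def by auto
  then have cB: "c \<in> B" "c' \<in> B"
    unfolding nonempty_cols_def by auto
  have neq: "c \<noteq> f" "c' \<noteq> f"
    using c f(2) unfolding nonempty_cols_def by auto
  define D where "D = {c, c', f}"
  define left where "left j x = {y \<in> {c, c'}. (x, y) \<in> (\<Union>l\<in>I - {i, j}. \<beta> l)}" for j x
  have left_iff: "y \<in> left j x \<longleftrightarrow> (y = c \<or> y = c') \<and> (\<exists>l\<in>I. l \<noteq> i \<and> l \<noteq> j \<and> (x, y) \<in> \<beta> l)" for j x y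
    unfolding left_def by auto
  \<comment> \<open>The links of \<open>i\<close> and \<open>j\<close> avoid all other marks, and
    the cells \<open>(r, c)\<close>, \<open>(r', c')\<close>, \<open>(s, y)\<close> pay for the
    three columns. So the deletion can only fail for lack of room.\<close>
  have room: "\<exists>x. card (B - D - row x) < card (left j x)"
    if j: "j \<in> I - {i}" "(s, y) \<in> \<beta> j" "y \<in> {c, c'}" for j s y
  proof -
    let ?Ei = "\<beta> i \<union> {r''} \<times> snd ` \<beta> i"
    let ?Ej = "\<beta> j \<union> fst ` \<beta> j \<times> {f}"
    have "\<exists>x\<in>A. card (B - D - row x) < card {y \<in> D. (x, y) \<in> (\<Union>l\<in>I - {i, j}. \<beta> l)}"
    proof (rule no_deletion[of D "{i, j}" "\<lambda>l. if l = i then ?Ei else ?Ej"])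
      have new: "(s, y) \<noteq> (r, c)" "(s, y) \<noteq> (r', c')"
        using j i block_eq[OF i(1), of j] by auto
      have "{(r, c), (r', c'), (s, y)} \<subseteq> (\<Union>l\<in>{i, j}. \<beta> l) \<inter> A \<times> D"
        using i j sub[OF i(1)] sub[of j] unfolding D_def by auto
      then have "card {(r, c), (r', c'), (s, y)} \<le> card ((\<Union>l\<in>{i, j}. \<beta> l) \<inter> A \<times> D)"
        using i j finite_block by (intro card_mono) auto
      moreover have "card {(r, c), (r', c'), (s, y)} = 3"
        using i(3) new by (auto simp: card_insert_if)
      moreover have "card D \<le> 3"
        unfolding D_def by (simp add: card_insert_le_m1)
      ultimately show "card D \<le> card ((\<Union>l\<in>{i, j}. \<beta> l) \<inter> A \<times> D)"
        by simp
      have "?Ei \<inter> \<beta> l = {}" if "l \<in> I - {i}" for l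
        using that r''_new[of l] block_eq[OF i(1), of l] by (auto simp: i(2))
      moreover have "?Ej \<inter> \<beta> l = {}" if "l \<in> I - {j}" for l
        using that f_new[of l] block_eq[of j l] j(1) by auto
      moreover have "{r''} \<times> snd ` \<beta> i \<inter> fst ` \<beta> j \<times> {f} = {}"
        using neq by (auto simp: i(2))
      ultimately have E: "?Ei \<inter> ?Ej = {}" "\<And>l. l \<in> I - {i, j} \<Longrightarrow> ?Ei \<inter> \<beta> l = {} \<and> ?Ej \<inter> \<beta> l = {}"
        using i(1) j(1) by (blast, blast)
      show "disjoint_family_on (\<lambda>l. if l = i then ?Ei else ?Ej) {i, j}"
        using E(1) by (auto simp: disjoint_family_on_def)
      show "(if l = i then ?Ei else ?Ej) \<inter> \<beta> m = {}" if "l \<in> {i, j}" "m \<in> I - {i, j}" for l m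
        using E(2)[OF that(2)] by simp
      have "?Ei \<subseteq> \<beta> i \<union> A \<times> D" "?Ej \<subseteq> \<beta> j \<union> A \<times> D"
        using r''(1) sub[of j] j(1) unfolding D_def by (auto simp: i(2))
      then show "\<beta> l \<subseteq> (if l = i then ?Ei else ?Ej) \<and> (if l = i then ?Ei else ?Ej) \<subseteq> \<beta> l \<union> A \<times> D \<and>
          joined (if l = i then ?Ei else ?Ej) (\<beta> l)" if "l \<in> {i, j}" for l
        using that joined_row[of "\<beta> i" r''] joined_column[of "\<beta> j" f] by auto
    qed (use cB f i j in \<open>auto simp: D_def\<close>)
    moreover have "{y \<in> D. (x, y) \<in> (\<Union>l\<in>I - {i, j}. \<beta> l)} = left j x" for x
      using f_new unfolding D_def left_def by auto
    ultimately show ?thesis by auto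
  qed
  have left_le: "card (left j x) \<le> 2" for j x
  proof -
    have "card (left j x) \<le> card {c, c'}"
      unfolding left_def by (intro card_mono) auto
    then show ?thesis
      using i(4) by simp
  qed
  have left_2: "left j x = {c, c'}" if "card (left j x) \<ge> 2" for j x
    using card_seteq[of "{c, c'}" "left j x"] that i(4) unfolding left_def by auto
  have left_0: "left j x \<noteq> {}" if "card (left j x) > 0" for j x
    using that by auto
  have fcells: "card (B - nonempty_cols) \<le> card (B - D - row x) + 1" for x
    using free_cells[OF f, of D x] c unfolding D_def by auto
  obtain x1 where x1: "card (B - D - row x1) < card (left j1 x1)"
    using room[OF j1] by auto
  have "card (B - nonempty_cols) > 0"
    using empty_col_exists fin by (simp add: card_gt_0_iff)
  \<comment> \<open>A crowded row has at most two cells to move, and its free places number at least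
    the empty columns minus one.\<close>
  then consider "card (B - nonempty_cols) = 1" | "card (B - nonempty_cols) = 2"
    using fcells[of x1] x1 left_le[of j1 x1] by linarith
  then show False
  proof cases
    case 1
    \<comment> \<open>Every nonempty column now has exactly two marks, so \<open>c\<close> and
      \<open>c'\<close> are marked only in rows \<open>r\<close> and \<open>r'\<close>.\<close>
    have two: "col y = {r, r'}" if "y \<in> nonempty_cols" "{r, r'} \<subseteq> col y" for y
      using card_seteq[OF finite_col that(2)] card_col_if_one_empty_col[OF 1 that(1)] i(3) by simp
    have "col c = {r, r'}" "col c' = {r, r'}"
      using two[OF c(1)] two[OF c(2)] in_cols by blast+
    moreover have "x \<in> col c \<or> x \<in> col c'" if "y \<in> left j x" for x y j
      using that unfolding left_iff in_col by blast
    ultimately have lr: "x \<in> {r, r'}" if "y \<in> left j x" for x y j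
      using that by blast
    have not_i: "(r, c) \<notin> \<beta> l" "(r', c') \<notin> \<beta> l" if "l \<in> I" "l \<noteq> i" for l
      using that i block_eq[OF i(1) that(1)] by auto
    have nj: "(r', c) \<notin> \<beta> l" if "l \<in> I" "l \<noteq> j1" for l
      using that j1 block_eq[of j1 l] by auto
    have nj2: "(r, c') \<notin> \<beta> l" if "l \<in> I" "l \<noteq> j2" for l
      using that j2 block_eq[of j2 l] by auto
    \<comment> \<open>Two of the four corners belong to \<open>i\<close> and one to the other linked
      block, so at most the fourth is left.\<close>
    have l1: "left j1 x \<subseteq> (if x = r then {c'} else {})" for x
      using lr[of _ j1 x] not_i nj by (auto simp: left_iff)
    have l2: "left j2 x \<subseteq> (if x = r' then {c} else {})" for x
      using lr[of _ j2 x] not_i nj2 i(3) by (auto simp: left_iff)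
    obtain x2 where x2: "card (B - D - row x2) < card (left j2 x2)"
      using room[OF j2] by auto
    have "x1 = r" "x2 = r'"
      using l1[of x1] l2[of x2] x1 x2 left_0[of j1 x1] left_0[of j2 x2]
      by (auto split: if_splits)
    moreover have "card (left j1 r) \<le> 1" "card (left j2 r') \<le> 1"
      using card_mono[OF _ l1[of r]] card_mono[OF _ l2[of r']] by auto
    ultimately have "card (B - D - row r) = 0" "card (B - D - row r') = 0"
      using x1 x2 by auto
    \<comment> \<open>The crowded rows \<open>r\<close> and \<open>r'\<close> have no free place, so
      they are marked everywhere outside \<open>D\<close>. Every nonempty column is then marked in
      just these two rows, and two nonempty rows are too few.\<close>
    then have "B - D \<subseteq> row r" "B - D \<subseteq> row r'"
      using fin by auto
    then have "{r, r'} \<subseteq> col y" if "y \<in> nonempty_cols" for y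
      using that in_cols f(2) unfolding D_def nonempty_cols_def row_def col_def by auto
    then have "col y = {r, r'}" if "y \<in> nonempty_cols" for y
      using two that by blast
    moreover have "x \<in> nonempty_rows \<Longrightarrow> \<exists>y\<in>nonempty_cols. x \<in> col y" for x
      using marks_sub unfolding nonempty_rows_def nonempty_cols_def row_def col_def by blast
    ultimately have "nonempty_rows \<subseteq> {r, r'}"
      by blast
    then have "card nonempty_rows \<le> 2"
      using card_mono[of "{r, r'}" nonempty_rows] i(3) by simp
    then show False
      using many_nonempty_lines card_empty_cols tight card_marks le 1 cols_count[of "{}"] by simp
  next
    case 2
    \<comment> \<open>Some free place exists, so a crowded row has both its cells left. Repeating
      the deletion with the owner \<open>j3\<close> of one of them gives a different crowded row
      \<open>x3\<close>.\<close>
    have x1': "left j1 x1 = {c, c'}"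
      using left_2[of j1 x1] x1 fcells[of x1] 2 by linarith
    then obtain j3 where j3: "j3 \<in> I" "j3 \<noteq> i" "(x1, c) \<in> \<beta> j3"
      using left_iff[of c j1 x1] by auto
    obtain x3 where x3: "card (B - D - row x3) < card (left j3 x3)"
      using room[of j3 x1 c] j3 by auto
    have x3': "left j3 x3 = {c, c'}"
      using left_2[of j3 x3] x3 fcells[of x3] 2 by linarith
    have avoid: "x \<noteq> r" "x \<noteq> r'" "x \<in> col c" "x \<in> col c'" if "left j x = {c, c'}" for j x
    proof -
      have "\<exists>l\<in>I. l \<noteq> i \<and> (x, c) \<in> \<beta> l" "\<exists>l\<in>I. l \<noteq> i \<and> (x, c') \<in> \<beta> l"
        using left_iff[of c j x] left_iff[of c' j x] that by auto
      then show "x \<noteq> r" "x \<noteq> r'" "x \<in> col c" "x \<in> col c'"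
        using i(1,2) block_eq[OF i(1)] by (auto simp: in_col)
    qed
    have "x1 \<noteq> x3"
      using left_iff[of c j3 x3] x3' j3 block_eq[OF j3(1)] by auto
    \<comment> \<open>Columns \<open>c\<close> and \<open>c'\<close> have four marks each, too many
      next to two in every other nonempty column.\<close>
    then have "card {r, r', x1, x3} = 4"
      using avoid[OF x1'] avoid[OF x3'] i(3) by auto
    moreover have "{r, r', x1, x3} \<subseteq> col c" "{r, r', x1, x3} \<subseteq> col c'"
      using avoid[OF x1'] avoid[OF x3'] in_cols by auto
    ultimately have "card (col c) \<ge> 4" "card (col c') \<ge> 4"
      using card_mono[OF finite_col] by metis+
    then show False
      using cols_count[of "{c, c'}"] c i(4) card_empty_cols 2 tight le by simp
  qed
qed

section \<open>Counting towards the contradiction\<close>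

lemma nonempty_lines:
  assumes "i \<in> I" "(r, c) \<in> \<beta> i"
  shows "r \<in> nonempty_rows" "c \<in> nonempty_cols"
proof -
  have "r \<in> A" "c \<in> B" "c \<in> row r" "r \<in> col c"
    using assms sub[OF assms(1)] in_row in_col by auto
  then show "r \<in> nonempty_rows" "c \<in> nonempty_cols"
    unfolding nonempty_rows_def nonempty_cols_def by auto
qed

text \<open>Inclusion-exclusion: the two columns cover all rows and share \<open>r\<close> and
  \<open>r'\<close>.\<close>

lemma heavy_cols:
  assumes "i \<in> I" "\<beta> i = {(r, c), (r', c')}" "r \<noteq> r'" "c \<noteq> c'"
    and "\<exists>j\<in>I - {i}. (r', c) \<in> \<beta> j" "\<exists>j\<in>I - {i}. (r, c') \<in> \<beta> j"
  shows "card (col c) + card (col c') \<ge> card A + 2"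
proof -
  have "A \<subseteq> col c \<union> col c'"
    using cols_cover[OF assms(1-4)] assms(5,6) by blast
  then have "card A \<le> card (col c \<union> col c')"
    using finite_col by (intro card_mono) auto
  moreover have "{r, r'} \<subseteq> col c \<inter> col c'"
    using assms by (auto simp: in_col)
  then have "card {r, r'} \<le> card (col c \<inter> col c')"
    using finite_col by (intro card_mono) auto
  ultimately show ?thesis
    using card_Un_Int[OF finite_col finite_col, of c c'] assms(3) by simp
qed

text \<open>Otherwise four distinct columns hold at least \<open>2 * card A + 4\<close> marks. With
  two more in each other nonempty column, this contradicts
  \<open>many_nonempty_lines\<close>.\<close>

lemma cols_meet:
  assumes "i \<in> blocks" "j \<in> blocks"
  shows "snd ` \<beta> i \<inter> snd ` \<beta> j \<noteq> {}"
proof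
  assume no: "snd ` \<beta> i \<inter> snd ` \<beta> j = {}"
  have I: "i \<in> I" "j \<in> I"
    using assms unfolding blocks_def by auto
  obtain r c r' c' where i: "r \<noteq> r'" "c \<noteq> c'" "\<beta> i = {(r, c), (r', c')}"
    "\<exists>j\<in>I - {i}. (r', c) \<in> \<beta> j" "\<exists>j\<in>I - {i}. (r, c') \<in> \<beta> j"
    by (rule block_cases[OF assms(1)])
  obtain s d s' d' where j: "s \<noteq> s'" "d \<noteq> d'" "\<beta> j = {(s, d), (s', d')}"
    "\<exists>l\<in>I - {j}. (s', d) \<in> \<beta> l" "\<exists>l\<in>I - {j}. (s, d') \<in> \<beta> l"
    by (rule block_cases[OF assms(2)])
  have "{c, c', d, d'} \<subseteq> nonempty_cols"
    using nonempty_lines(2)[OF I(1)] nonempty_lines(2)[OF I(2)] by (auto simp: i(3) j(3))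
  moreover have "c \<noteq> d" "c \<noteq> d'" "c' \<noteq> d" "c' \<noteq> d'"
    using no by (auto simp: i(3) j(3))
  ultimately have "card (col c) + card (col c') + card (col d) + card (col d') + 2 * card nonempty_cols
      \<le> card marks + 8"
    using cols_count[of "{c, c', d, d'}"] i(2) j(2) by simp
  moreover have "card nonempty_rows \<le> card A"
    using fin by (intro card_mono) (auto simp: nonempty_rows_def)
  ultimately show False
    using heavy_cols[OF I(1) i(3,1,2,4,5)] heavy_cols[OF I(2) j(3,1,2,4,5)]
      many_nonempty_lines card_marks by linarith
qed

text \<open>Beside a marked cell, its row contains another marked corner of the rectangle.\<close>

lemma card_row_ge_2: "r \<in> nonempty_rows \<Longrightarrow> 2 \<le> card (row r)"
proof -
  assume "r \<in> nonempty_rows"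
  then obtain i c where i: "i \<in> I" "(r, c) \<in> \<beta> i"
    unfolding nonempty_rows_def using in_row by blast
  then obtain r' c' where c': "c \<noteq> c'" "\<exists>j\<in>I - {i}. (r, c') \<in> \<beta> j"
    by (rule block_is_rectangle)
  then have "{c, c'} \<subseteq> row r"
    using i in_row by blast
  then show ?thesis
    using card_mono[OF finite_row, of "{c, c'}" r] c'(1) by simp
qed

lemma rows_count:
  "T \<subseteq> nonempty_rows \<Longrightarrow> (\<Sum>r\<in>T. card (row r)) + 2 * card nonempty_rows \<le> card marks + 2 * card T"
  unfolding card_marks_rows by (rule sum_ge_2_card[OF finite_nonempty(2) _ card_row_ge_2])

text \<open>Different blocks have different cells in column \<open>c\<close>, hence in different
  rows.\<close>

lemma card_blocks_le_if_common_col: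
  assumes "\<And>i. i \<in> blocks \<Longrightarrow> c \<in> snd ` \<beta> i"
  shows "card blocks \<le> card nonempty_rows"
proof -
  have "\<forall>i\<in>blocks. \<exists>r. (r, c) \<in> \<beta> i"
    using assms by fastforce
  then obtain g where g: "\<And>i. i \<in> blocks \<Longrightarrow> (g i, c) \<in> \<beta> i"
    by metis
  have "inj_on g blocks"
  proof (rule inj_onI)
    show "i = j" if "i \<in> blocks" "j \<in> blocks" "g i = g j" for i j
      using block_eq[of i j "(g i, c)"] g[OF that(1)] g[OF that(2)] that unfolding blocks_def by auto
  qed
  moreover have "g ` blocks \<subseteq> nonempty_rows"
    using g nonempty_lines(1) unfolding blocks_def by blast
  ultimately show ?thesis
    using card_inj_on_le finite_nonempty(2) by blast
qed

lemma contradiction: False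
proof -
  \<comment> \<open>Two marks per nonempty row give
    \<open>card nonempty_rows \<le> card blocks\<close>.\<close>
  have cols: "card nonempty_cols \<ge> 3"
    using rows_count[of "{}"] many_nonempty_lines card_marks by simp
  have "card blocks \<le> card nonempty_rows"
  proof (cases "card nonempty_cols \<ge> 4")
    \<comment> \<open>The column pairs of the blocks meet pairwise and cover at least four columns,
      so they share one.\<close>
    case True
    have "nonempty_cols = (\<Union>i\<in>blocks. snd ` \<beta> i)"
    proof (intro subset_antisym subsetI)
      show "c \<in> (\<Union>i\<in>blocks. snd ` \<beta> i)" if "c \<in> nonempty_cols" for c
        using that in_col unfolding nonempty_cols_def blocks_def by force
      show "c \<in> nonempty_cols" if "c \<in> (\<Union>i\<in>blocks. snd ` \<beta> i)" for c
        using that nonempty_lines(2) unfolding blocks_def by auto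
    qed
    then have "card (\<Union>i\<in>blocks. snd ` \<beta> i) \<ge> 4"
      using True by simp
    moreover have "card (snd ` \<beta> i) = 2" if "i \<in> blocks" for i
      using that by (rule block_cases) simp
    ultimately obtain c where "\<forall>i\<in>blocks. c \<in> snd ` \<beta> i"
      using common_element_of_pairs[of blocks "\<lambda>i. snd ` \<beta> i"] cols_meet by blast
    then show ?thesis
      using card_blocks_le_if_common_col by blast
  next
    case False
    then show ?thesis
      using cols many_nonempty_lines by simp
  qed
  \<comment> \<open>There are at most \<open>2 * card nonempty_rows\<close> marks, and every
    nonempty row already has two.\<close>
  then have row_2: "card (row r) \<le> 2" if "r \<in> nonempty_rows" for r
    using rows_count[of "{r}"] that card_marks by simp
  have "blocks \<noteq> {}"
    using cols cols_count[of "{}"] card_marks by auto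
  then obtain i where i: "i \<in> blocks" by blast
  obtain r c r' c' where rc: "r \<noteq> r'" "c \<noteq> c'" "\<beta> i = {(r, c), (r', c')}"
    "\<exists>j\<in>I - {i}. (r', c) \<in> \<beta> j" "\<exists>j\<in>I - {i}. (r, c') \<in> \<beta> j"
    by (rule block_cases[OF i])
  have iI: "i \<in> I"
    using i unfolding blocks_def by simp
  have row_eq: "row \<rho> = {c, c'}" if "\<rho> \<in> {r, r'}" for \<rho>
  proof -
    have "{c, c'} \<subseteq> row \<rho>"
      using that rc iI by (auto simp: in_row)
    moreover have "\<rho> \<in> nonempty_rows"
      using that nonempty_lines(1)[OF iI] by (auto simp: rc(3))
    ultimately show ?thesis
      using card_seteq[OF finite_row, of "{c, c'}" \<rho>] row_2[of \<rho>] rc(2) by (simp add: eq_commute)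
  qed
  \<comment> \<open>Block \<open>j\<close> shares a column with \<open>i\<close>, hence a row. That
    row is marked only in \<open>c\<close> and \<open>c'\<close>, and it contains marked corners in
    both columns of \<open>j\<close>.\<close>
  have "snd ` \<beta> j \<subseteq> {c, c'}" if j: "j \<in> blocks" for j
  proof -
    have jI: "j \<in> I"
      using j unfolding blocks_def by simp
    obtain d a b where "(a, d) \<in> \<beta> i" "(b, d) \<in> \<beta> j"
      using cols_meet[OF i j] by auto
    then have "fst ` \<beta> i \<inter> fst ` \<beta> j \<noteq> {}"
      using rows_meet[OF iI jI] by blast
    then have "\<exists>y. (r, y) \<in> \<beta> j \<or> (r', y) \<in> \<beta> j"
      by (auto simp: rc(3))
    then obtain \<rho> y where y: "\<rho> \<in> {r, r'}" "(\<rho>, y) \<in> \<beta> j"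
      by blast
    obtain \<sigma> z where z: "\<beta> j = {(\<rho>, y), (\<sigma>, z)}" "\<exists>l\<in>I - {j}. (\<rho>, z) \<in> \<beta> l"
      by (rule block_is_rectangle[OF jI y(2)])
    have "y \<in> row \<rho>" "z \<in> row \<rho>"
      using y z jI by (auto simp: in_row)
    then show ?thesis
      using row_eq[OF y(1)] z(1) by auto
  qed
  then have "nonempty_cols \<subseteq> {c, c'}"
    using in_col unfolding nonempty_cols_def blocks_def by fastforce
  then show False
    using card_mono[of "{c, c'}" nonempty_cols] cols rc(2) by simp
qed

end

lemma linkable_if_fewer_columns:
  assumes "rook_blocks A B I \<beta>" "card A \<le> card B"
    and "\<And>B' \<gamma>. B' \<subset> B \<Longrightarrow> rook_blocks A B' I \<gamma> \<Longrightarrow> linkable A B' I \<gamma>"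
  shows "linkable A B I \<beta>"
proof (rule ccontr)
  assume "\<not> linkable A B I \<beta>"
  with assms interpret stuck_blocks A B I \<beta>
    by (simp add: stuck_blocks_def stuck_blocks_axioms_def)
  show False
    by (rule contradiction)
qed

subsection \<open>Linking blocks in arbitrary grids\<close>

lemma rook_blocks_swap:
  assumes "rook_blocks A B I \<beta>"
  shows "rook_blocks B A I (\<lambda>i. prod.swap ` \<beta> i)"
proof -
  interpret rook_blocks A B I \<beta> by fact
  have "(\<Union>i\<in>I. prod.swap ` \<beta> i) = prod.swap ` marks"
    by blast
  then have "card (\<Union>i\<in>I. prod.swap ` \<beta> i) = card marks"
    by (simp add: card_image)
  then show ?thesis
  proof (unfold_locales, goal_cases)
    case 4
    then show ?case
      using disj unfolding disjoint_family_on_def by (simp flip: image_Int)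
  next
    case (5 i)
    then show ?case
      using sub[of i] by auto
  qed (use fin card2 few in \<open>simp_all add: card_image add.commute\<close>)
qed

lemma joined_swap: "joined C S \<Longrightarrow> joined (prod.swap ` C) (prod.swap ` S)"
proof -
  have "(prod.swap x, prod.swap y) \<in> (rook \<inter> prod.swap ` C \<times> prod.swap ` C)\<^sup>*"
    if "(x, y) \<in> (rook \<inter> C \<times> C)\<^sup>*" for x y
    using that
  proof induction
    case (step y z)
    then have "(prod.swap y, prod.swap z) \<in> rook \<inter> prod.swap ` C \<times> prod.swap ` C"
      by (auto simp: rook_def)
    with step.IH show ?case
      by (rule rtrancl_into_rtrancl)
  qed simp
  then show "joined C S \<Longrightarrow> joined (prod.swap ` C) (prod.swap ` S)"
    unfolding joined_def by blast
qed

lemma linkable_swap: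
  assumes "linkable A B I \<beta>"
  shows "linkable B A I (\<lambda>i. prod.swap ` \<beta> i)"
proof -
  obtain C where C: "disjoint_family_on C I"
    "\<And>i. i \<in> I \<Longrightarrow> \<beta> i \<subseteq> C i \<and> C i \<subseteq> A \<times> B \<and> joined (C i) (\<beta> i)"
    using assms unfolding linkable_def by meson
  show ?thesis
    unfolding linkable_def
  proof (intro exI[of _ "\<lambda>i. prod.swap ` C i"] conjI ballI)
    show "disjoint_family_on (\<lambda>i. prod.swap ` C i) I"
      using C(1) unfolding disjoint_family_on_def by (simp flip: image_Int)
    show "prod.swap ` \<beta> i \<subseteq> prod.swap ` C i" "prod.swap ` C i \<subseteq> B \<times> A"
      "joined (prod.swap ` C i) (prod.swap ` \<beta> i)" if "i \<in> I" for i
      using C(2)[OF that] joined_swap by auto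
  qed
qed

text \<open>A grid with more rows than columns is transposed, so that columns can be
  deleted.\<close>

theorem rook_blocks_linkable: "rook_blocks A B I \<beta> \<Longrightarrow> linkable A B I \<beta>"
proof (induction "card A + card B" arbitrary: A B \<beta> rule: less_induct)
  case less
  then have fin: "finite A" "finite B"
    by (auto simp: rook_blocks_def)
  show ?case
  proof (cases "card A \<le> card B")
    case True
    show ?thesis
    proof (rule linkable_if_fewer_columns[OF less.prems True])
      show "linkable A B' I \<gamma>" if "B' \<subset> B" "rook_blocks A B' I \<gamma>" for B' \<gamma>
        using less.hyps[OF _ that(2)] psubset_card_mono[OF fin(2) that(1)] by simp
    qed
  next
    case False
    have "linkable B A I (\<lambda>i. prod.swap ` \<beta> i)"
    proof (rule linkable_if_fewer_columns[OF rook_blocks_swap[OF less.prems]])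
      fix A' \<gamma> assume A': "A' \<subset> A" "rook_blocks B A' I \<gamma>"
      have "linkable A' B I (\<lambda>i. prod.swap ` \<gamma> i)"
        using less.hyps[OF _ rook_blocks_swap[OF A'(2)]] psubset_card_mono[OF fin(1) A'(1)] by simp
      then show "linkable B A' I \<gamma>"
        using linkable_swap[of A' B I "\<lambda>i. prod.swap ` \<gamma> i"] by (simp add: image_image)
    qed (use False in simp)
    then show ?thesis
      using linkable_swap[of B A I "\<lambda>i. prod.swap ` \<beta> i"] by (simp add: image_image)
  qed
qed

subsection \<open>The graph of a product of simplices\<close>

text \<open>A step to a cell already on the path cuts the path back to that cell; this also absorbs
  the reflexive steps of \<open>rook\<close>.\<close>

lemma distinct_rook_path:
  assumes "(x, y) \<in> (rook \<inter> C \<times> C)\<^sup>*" "x \<in> C"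
  shows "\<exists>p. p \<noteq> [] \<and> hd p = x \<and> last p = y \<and> set p \<subseteq> C \<and> distinct p \<and> set (vwalk_arcs p) \<subseteq> rook"
  using assms
proof induction
  case base
  then show ?case
    by (intro exI[of _ "[x]"]) auto
next
  case (step y z)
  then obtain p where p: "p \<noteq> []" "hd p = x" "last p = y" "set p \<subseteq> C" "distinct p"
      "set (vwalk_arcs p) \<subseteq> rook"
    by blast
  show ?case
  proof (cases "z \<in> set p")
    case True
    then obtain q r where "p = q @ z # r"
      by (meson split_list)
    then have eq: "p = (q @ [z]) @ r"
      by simp
    have "set (vwalk_arcs (q @ [z])) \<subseteq> set (vwalk_arcs p)"
      unfolding eq by (rule set_vwalk_arcs_append1)
    moreover have "hd (q @ [z]) = x"
      using p(2) eq by (cases q) auto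
    ultimately show ?thesis
      using p(4-6) eq by (intro exI[of _ "q @ [z]"]) auto
  next
    case False
    have "vwalk_arcs (p @ [z]) = vwalk_arcs p @ [(last p, z)]"
      using p(1) by (simp add: vwalk_arcs_append)
    then show ?thesis
      using p step.hyps(2) False by (intro exI[of _ "p @ [z]"]) auto
  qed
qed

lemma closed_segment_in_fibre:
  "closed_segment (x, y) (x, y') = {x} \<times> closed_segment y y'"
  "closed_segment (x, y) (x', y) = closed_segment x x' \<times> {y}"
  by (auto simp: in_segment algebra_simps simp flip: scaleR_add_left)

text \<open>Every set of vertices of a simplex spans a face; \<open>x = y\<close> gives a
  vertex.\<close>

lemma simplex_edge:
  fixes V :: "'a::euclidean_space set"
  assumes "\<not> affine_dependent V" "x \<in> V" "y \<in> V"
  shows "closed_segment x y face_of convex hull V"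
  using assms(2,3) unfolding face_of_convex_hull_affine_independent[OF assms(1)] segment_convex_hull
  by (intro exI[of _ "{x, y}"]) simp

text \<open>Cells on a common line differ in one coordinate, so their segment is an edge of one
  factor times a vertex of the other.\<close>

lemma rook_arc_in_polytope_graph:
  fixes V :: "'a::euclidean_space set" and W :: "'b::euclidean_space set"
  assumes V: "\<not> affine_dependent V" and W: "\<not> affine_dependent W"
    and "u \<in> V \<times> W" "v \<in> V \<times> W" "u \<noteq> v" "(u, v) \<in> rook"
  shows "(u, v) \<in> parcs (polytope_graph ((convex hull V) \<times> (convex hull W)))"
proof -
  have vertex: "{x} face_of convex hull V" "{y} face_of convex hull W" if "x \<in> V" "y \<in> W" for x y
    using that V W by (simp_all add: face_of_singleton extreme_point_of_convex_hull_affine_independent)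
  obtain x y x' y' where uv: "u = (x, y)" "v = (x', y')"
    by (cases u, cases v)
  have "closed_segment u v face_of ((convex hull V) \<times> (convex hull W))"
    using assms(3-6) simplex_edge[OF V, of x x'] simplex_edge[OF W, of y y'] vertex
    by (auto simp: uv rook_def closed_segment_in_fibre intro!: face_of_Times)
  moreover have "aff_dim (closed_segment u v) = 1"
    using assms(5) by (simp add: segment_convex_hull aff_dim_convex_hull)
  ultimately show ?thesis
    by (simp add: polytope_graph_def edge_of_def)
qed

lemma verts_polytope_graph_simplices:
  fixes V :: "'a::euclidean_space set" and W :: "'b::euclidean_space set"
  assumes "\<not> affine_dependent V" "\<not> affine_dependent W"
  shows "pverts (polytope_graph ((convex hull V) \<times> (convex hull W))) = V \<times> W"
proof -
  have "{(x, y)} face_of ((convex hull V) \<times> (convex hull W)) \<longleftrightarrow> x \<in> V \<and> y \<in> W" for x y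
    using face_of_Times_eq[of "{x}" "{y}" "convex hull V" "convex hull W"] assms
    by (simp add: face_of_singleton extreme_point_of_convex_hull_affine_independent)
  then show ?thesis
    by (auto simp: polytope_graph_def face_of_singleton)
qed

lemma rook_vpath:
  fixes V :: "'a::euclidean_space set" and W :: "'b::euclidean_space set"
  assumes V: "\<not> affine_dependent V" and W: "\<not> affine_dependent W"
    and p: "p \<noteq> []" "set p \<subseteq> V \<times> W" "distinct p" "set (vwalk_arcs p) \<subseteq> rook"
  shows "vpath p (with_proj (polytope_graph ((convex hull V) \<times> (convex hull W))))"
proof -
  have "set (vwalk_arcs p) \<subseteq> parcs (polytope_graph ((convex hull V) \<times> (convex hull W)))"
    using p
  proof (induction p rule: vwalk_arcs.induct)
    case (3 u v vs)
    then show ?case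
      using rook_arc_in_polytope_graph[OF V W, of u v] by auto
  qed auto
  then show ?thesis
    using p verts_polytope_graph_simplices[OF V W]
    by (auto simp: vpath_def vwalk_def arcs_ends_def arc_to_ends_def)
qed

lemma terminals_distinct:
  fixes s t :: "nat \<Rightarrow> 'a"
  assumes "card (\<Union>i<k. {s i, t i}) = 2 * k"
  shows "disjoint_family_on (\<lambda>i. {s i, t i}) {..<k}"
proof -
  \<comment> \<open>\<open>h\<close> lists the terminals by \<open>2 * k\<close> indices; an image
    of that size makes it injective.\<close>
  define h where "h = (\<lambda>(i, b). if b then s i else t i)"
  have "{..<k} \<times> (UNIV :: bool set) = (\<Union>i<k. {(i, True), (i, False)})"
    by (auto simp: UNIV_bool)
  then have "h ` ({..<k} \<times> UNIV) = (\<Union>i<k. {s i, t i})"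
    by (simp add: image_UN h_def)
  then have "card (h ` ({..<k} \<times> UNIV)) = card ({..<k} \<times> (UNIV :: bool set))"
    using assms by (simp add: card_cartesian_product)
  then have inj: "inj_on h ({..<k} \<times> UNIV)"
    by (intro eq_card_imp_inj_on) auto
  show ?thesis
    unfolding disjoint_family_on_def
  proof (intro ballI impI)
    fix i j assume ij: "i \<in> {..<k}" "j \<in> {..<k}" "i \<noteq> j"
    then have "h (i, b) \<noteq> h (j, b')" for b b'
      using inj by (auto simp: inj_on_def)
    from this[of True True] this[of True False] this[of False True] this[of False False]
    show "{s i, t i} \<inter> {s j, t j} = {}"
      by (auto simp: h_def)
  qed
qed

theorem corollary4:
  fixes d1 d2 :: nat
    and T1 :: "'a::euclidean_space set"
    and T2 :: "'b::euclidean_space set"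
  assumes "int d1 simplex T1"
    and "int d2 simplex T2"
  shows "polytope_k_linked ((d1 + d2) div 2) (T1 \<times> T2)"
proof -
  obtain V where V: "\<not> affine_dependent V" "int (card V) = int d1 + 1" "T1 = convex hull V"
    using assms(1) unfolding simplex_def by blast
  obtain W where W: "\<not> affine_dependent W" "int (card W) = int d2 + 1" "T2 = convex hull W"
    using assms(2) unfolding simplex_def by blast
  define k where "k = (d1 + d2) div 2"
  define G where "G = with_proj (polytope_graph (T1 \<times> T2))"
  have verts: "verts G = V \<times> W"
    using verts_polytope_graph_simplices[OF V(1) W(1)] unfolding G_def V(3) W(3) by simp
  have cards: "card V = d1 + 1" "card W = d2 + 1"
    using V(2) W(2) by simp_all
  have "2 * k \<le> d1 + d2"
    unfolding k_def by simp
  then have "2 * k \<le> card (verts G)"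
    by (simp add: verts card_cartesian_product cards)
  moreover have "\<exists>L. (\<forall>i<k. vpath (L i) G \<and> hd (L i) = s i \<and> last (L i) = t i) \<and>
      disjoint_family_on (\<lambda>i. set (L i)) {..<k}"
    if X: "(\<Union>i<k. {s i, t i}) \<subseteq> verts G" "card (\<Union>i<k. {s i, t i}) = 2 * k" for s t
  proof -
    have "rook_blocks V W {..<k} (\<lambda>i. {s i, t i})"
    proof
      \<comment> \<open>The simplices have \<open>d1 + d2 + 2\<close> vertices together, which is
        what the bound on the marks requires.\<close>
      show "card (\<Union>i<k. {s i, t i}) + 2 \<le> card V + card W"
        using X(2) \<open>2 * k \<le> d1 + d2\<close> cards by simp
    qed (use X verts aff_independent_finite[OF V(1)] aff_independent_finite[OF W(1)]
          terminals_distinct[OF X(2)] in \<open>auto simp: card_insert_if\<close>)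
    from rook_blocks_linkable[OF this] obtain C where
      "disjoint_family_on C {..<k} \<and>
        (\<forall>i\<in>{..<k}. {s i, t i} \<subseteq> C i \<and> C i \<subseteq> V \<times> W \<and> joined (C i) {s i, t i})"
      unfolding linkable_def by (rule exE)
    then have C: "disjoint_family_on C {..<k}"
      "\<And>i. i < k \<Longrightarrow> {s i, t i} \<subseteq> C i \<and> C i \<subseteq> V \<times> W \<and> joined (C i) {s i, t i}"
      by simp_all
    \<comment> \<open>Each path stays in its own set \<open>C i\<close>, so the paths are
      disjoint.\<close>
    have "\<exists>p. vpath p G \<and> hd p = s i \<and> last p = t i \<and> set p \<subseteq> C i" if "i < k" for i
    proof -
      have "(s i, t i) \<in> (rook \<inter> C i \<times> C i)\<^sup>*" "s i \<in> C i"
        using C(2)[OF that] unfolding joined_def by auto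
      from distinct_rook_path[OF this] obtain p where
        "p \<noteq> []" "hd p = s i" "last p = t i" "set p \<subseteq> C i" "distinct p" "set (vwalk_arcs p) \<subseteq> rook"
        by blast
      moreover from this have "vpath p G"
        using C(2)[OF that] rook_vpath[OF V(1) W(1), of p] unfolding G_def V(3) W(3) by blast
      ultimately show ?thesis by blast
    qed
    then obtain L where L: "\<And>i. i < k \<Longrightarrow> vpath (L i) G \<and> hd (L i) = s i \<and> last (L i) = t i \<and> set (L i) \<subseteq> C i"
      by metis
    have "disjoint_family_on (\<lambda>i. set (L i)) {..<k}"
      unfolding disjoint_family_on_def
    proof (intro ballI impI)
      fix i j assume "i \<in> {..<k}" "j \<in> {..<k}" "i \<noteq> j"
      then show "set (L i) \<inter> set (L j) = {}"
        using C(1) L[of i] L[of j] unfolding disjoint_family_on_def by blast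
    qed
    then show ?thesis
      using L by blast
  qed
  ultimately show ?thesis
    unfolding polytope_k_linked_def k_linked_def k_def[symmetric] G_def[symmetric] by blast
qed

end
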